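(* Let $\mathcal Y\subseteq\mathbb R^d$ be a nonempty compact convex set and $\mathcal X\subseteq\mathbb R^n$ a nonempty closed convex set, let $f:\mathbb R^n\times\mathbb R^d\to\mathbb R$ be continuously differentiable with $L$-Lipschitz partial gradients on $\mathcal X\times\mathcal Y$ (in the sense of the context, $L\ge1$), and consider the problem $\min_{x\in\mathcal X}\max_{y\in\mathcal Y}f(x,y)$. For any integer $T>1$, one can select parameters $0<r_x,r_y,\eta_x,\eta_y,\beta_x,\beta_y=\mathcal O(1)$ for the DS-OGDA algorithm such that there exists an index $t\in\{0,1,\dots,T-1\}$ for which the following hold: (i) (Concave dual) Suppose $f(x,\cdot)$ is concave for all $x\in\mathcal X$. If $\max_{y\in\mathcal Y}f(\cdot,y)$ is bounded below on $\mathcal X$ and $\beta_x\le\mathcal O(T^{-1/2})$, then $(x^{t+1},y^{t+1})$ is an $\mathcal O(T^{-1/4})$-game stationary point and $z^{t+1}$ is an $\mathcal O(T^{-1/4})$-optimization stationary point of the problem. (ii) (KŁ property) Suppose the dual KŁ property (see context) holds with exponent $\theta\in(0,1)$. If $\mathcal X$ is compact and $\beta_x\le\mathcal O\big(T^{-(2\theta-1)_+/(2\theta)}\big)$, then $(x^{t+1},y^{t+1})$ is an $\mathcal O\big(T^{-1/((4\theta-2)_++2)}\big)$-game stationary point and $z^{t+1}$ is an $\mathcal O\big(T^{-1/((4\theta-2)_++2)}\big)$-optimization stationary point of the problem.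
   Context: Norms are Euclidean, $a_+=\max\{a,0\}$. $\iota_{\mathcal X}$ is the indicator function of $\mathcal X$ ($0$ on $\mathcal X$, $+\infty$ elsewhere), and $\partial\iota_{\mathcal X}(x)$ is the normal cone. $\mathrm{dist}$ is Euclidean distance to a set, $\mathrm{proj}$ Euclidean projection. The notation $\mathcal O(\cdot)$ hides constants independent of $T$. Smoothness: for all $x,x'\in\mathcal X$, $y,y'\in\mathcal Y$, both $\|\nabla_xf(x,y)-\nabla_xf(x',y')\|$ and $\|\nabla_yf(x,y)-\nabla_yf(x',y')\|$ are at most $L(\|x-x'\|+\|y-y'\|)$. Dual KŁ property: for all $x\in\mathcal X$, $\max_{y\in\mathcal Y}f(x,y)$ has a nonempty solution set and finite optimal value, and there are $\tau_y>0$, $\theta\in(0,1)$ with $\big(\max_{y'\in\mathcal Y}f(x,y')-f(x,y)\big)^\theta\le\frac1{\tau_y}\mathrm{dist}(0,-\nabla_yf(x,y)+\partial\iota_{\mathcal Y}(y))$ for all $x\in\mathcal X,y\in\mathcal Y$. DS-OGDA. Let $F(x,y,z,v)=f(x,y)+\frac{r_x}2\|x-z\|^2-\frac{r_y}2\|y-v\|^2$, $G_x=\nabla_xF$, $G_y=-\nabla_yF$, and let $G_x^t,G_y^t$ be their values at $(x^t,y^t,z^t,v^t)$. Starting from $x^0\in\mathcal X$, $y^0\in\mathcal Y$ with $x^{-1}=x^0$, $y^{-1}=y^0$, $z^{-1}=z^0=x^0$, $v^{-1}=v^0=y^0$, step sizes $\eta_x,\eta_y>0$ and $0<\beta_x,\beta_y<1$,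 for $t=0,1,2,\dots$: $x^{t+1}=\mathrm{proj}_{\mathcal X}(x^t-\eta_xG_x^t+\eta_x(G_x^{t-1}-G_x^t))$, $y^{t+1}=\mathrm{proj}_{\mathcal Y}(y^t-\eta_yG_y^t+\eta_y(G_y^{t-1}-G_y^t))$, $z^{t+1}=z^t+\beta_x(x^t-z^t)$, $v^{t+1}=v^t+\beta_y(y^t-v^t)$. Stationarity. $(x,y)\in\mathcal X\times\mathcal Y$ is an $\epsilon$-game stationary point if $\mathrm{dist}(0,\nabla_xf(x,y)+\partial\iota_{\mathcal X}(x))\le\epsilon$ and $\mathrm{dist}(0,-\nabla_yf(x,y)+\partial\iota_{\mathcal Y}(y))\le\epsilon$. Given $r>L$, a point $x\in\mathcal X$ is an $\epsilon$-optimization stationary point if $\|\mathrm{prox}_{\phi/r}(x)-x\|\le\epsilon$, where $\phi(x)=\max_{y'\in\mathcal Y}f(x,y')+\iota_{\mathcal X}(x)$ and $\mathrm{prox}_{\phi/r}(x)=\arg\min_{x'}\{\phi(x')+\frac r2\|x'-x\|^2\}$. *)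

theory Defs
  imports "HOL-Analysis.Analysis" "HOL-Library.Landau_Symbols"
begin

definition grad :: "('a::euclidean_space \<Rightarrow> real) \<Rightarrow> 'a \<Rightarrow> 'a" where
  "grad g a = (THE D. GDERIV g a :> D)"

definition cont_differentiable :: "('a::euclidean_space \<Rightarrow> real) \<Rightarrow> bool" where
  "cont_differentiable g \<longleftrightarrow>
     (\<forall>a. g differentiable (at a)) \<and> continuous_on UNIV (grad g)"

definition grad_x :: "('a::euclidean_space \<Rightarrow> 'b::euclidean_space \<Rightarrow> real) \<Rightarrow> 'a \<Rightarrow> 'b \<Rightarrow> 'a" where
  "grad_x f x y = grad (\<lambda>u. f u y) x"

definition grad_y :: "('a::euclidean_space \<Rightarrow> 'b::euclidean_space \<Rightarrow> real) \<Rightarrow> 'a \<Rightarrow> 'b \<Rightarrow> 'b" where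
  "grad_y f x y = grad (\<lambda>w. f x w) y"

definition lipschitz_grads ::
  "real \<Rightarrow> 'a::euclidean_space set \<Rightarrow> 'b::euclidean_space set \<Rightarrow> ('a \<Rightarrow> 'b \<Rightarrow> real) \<Rightarrow> bool" where
  "lipschitz_grads L X Y f \<longleftrightarrow>
     (\<forall>x\<in>X. \<forall>x'\<in>X. \<forall>y\<in>Y. \<forall>y'\<in>Y.
        norm (grad_x f x y - grad_x f x' y') \<le> L * (norm (x - x') + norm (y - y')) \<and>
        norm (grad_y f x y - grad_y f x' y') \<le> L * (norm (x - x') + norm (y - y')))"

definition normal_cone :: "'a::euclidean_space set \<Rightarrow> 'a \<Rightarrow> 'a set" where
  "normal_cone S a = {u. a \<in> S \<and> (\<forall>w\<in>S. u \<bullet> (w - a) \<le> 0)}"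

text \<open>\<open>infdist\<close> returns 0 for the empty set; the measure below is only used at points
  of \<open>S\<close>, where the normal cone contains 0.\<close>

definition stat_dist :: "'a::euclidean_space set \<Rightarrow> 'a \<Rightarrow> 'a \<Rightarrow> real" where
  "stat_dist S g a = infdist 0 ((\<lambda>u. g + u) ` normal_cone S a)"

definition max_val :: "'b set \<Rightarrow> ('a \<Rightarrow> 'b \<Rightarrow> real) \<Rightarrow> 'a \<Rightarrow> real" where
  "max_val Y f x = (SUP y\<in>Y. f x y)"

definition game_stationary ::
  "'a::euclidean_space set \<Rightarrow> 'b::euclidean_space set \<Rightarrow> ('a \<Rightarrow> 'b \<Rightarrow> real) \<Rightarrow> real \<Rightarrow> 'a \<Rightarrow> 'b \<Rightarrow> bool" where
  "game_stationary X Y f \<epsilon> x y \<longleftrightarrow>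
     x \<in> X \<and> y \<in> Y \<and>
     stat_dist X (grad_x f x y) x \<le> \<epsilon> \<and>
     stat_dist Y (- grad_y f x y) y \<le> \<epsilon>"

definition indicator_fun :: "'a set \<Rightarrow> 'a \<Rightarrow> ereal" where
  "indicator_fun S a = (if a \<in> S then 0 else \<infinity>)"

text \<open>\<open>prox \<phi> r a\<close> is the proximal point of \<open>\<phi> / r\<close> at \<open>a\<close>. It is meaningful when the
  minimizer is unique, as is the case for the functions below once \<open>r > L\<close>.\<close>

definition prox :: "('a::euclidean_space \<Rightarrow> ereal) \<Rightarrow> real \<Rightarrow> 'a \<Rightarrow> 'a" where
  "prox \<phi> r a = arg_min (\<lambda>u. \<phi> u + ereal (r / 2 * (norm (u - a))\<^sup>2)) (\<lambda>_. True)"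

definition primal_fun :: "'a set \<Rightarrow> 'b set \<Rightarrow> ('a \<Rightarrow> 'b \<Rightarrow> real) \<Rightarrow> 'a \<Rightarrow> ereal" where
  "primal_fun X Y f x = ereal (max_val Y f x) + indicator_fun X x"

definition opt_stationary ::
  "'a::euclidean_space set \<Rightarrow> 'b set \<Rightarrow> ('a \<Rightarrow> 'b \<Rightarrow> real) \<Rightarrow> real \<Rightarrow> real \<Rightarrow> 'a \<Rightarrow> bool" where
  "opt_stationary X Y f r \<epsilon> x \<longleftrightarrow>
     x \<in> X \<and> norm (prox (primal_fun X Y f) r x - x) \<le> \<epsilon>"

definition dual_KL ::
  "'a::euclidean_space set \<Rightarrow> 'b::euclidean_space set \<Rightarrow> ('a \<Rightarrow> 'b \<Rightarrow> real) \<Rightarrow> real \<Rightarrow> bool" where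
  "dual_KL X Y f \<theta> \<longleftrightarrow>
     (\<forall>x\<in>X. \<exists>y\<in>Y. \<forall>y'\<in>Y. f x y' \<le> f x y) \<and>
     (\<exists>\<tau>>0. \<forall>x\<in>X. \<forall>y\<in>Y.
        (max_val Y f x - f x y) powr \<theta> \<le> 1 / \<tau> * stat_dist Y (- grad_y f x y) y)"

definition smoothed ::
  "('a::euclidean_space \<Rightarrow> 'b::euclidean_space \<Rightarrow> real) \<Rightarrow> real \<Rightarrow> real \<Rightarrow> 'a \<Rightarrow> 'b \<Rightarrow> 'a \<Rightarrow> 'b \<Rightarrow> real" where
  "smoothed f rx ry x y z v =
     f x y + rx / 2 * (norm (x - z))\<^sup>2 - ry / 2 * (norm (y - v))\<^sup>2"

definition G_x ::
  "('a::euclidean_space \<Rightarrow> 'b::euclidean_space \<Rightarrow> real) \<Rightarrow> real \<Rightarrow> real \<Rightarrow> 'a \<times> 'b \<times> 'a \<times> 'b \<Rightarrow> 'a" where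
  "G_x f rx ry = (\<lambda>(x, y, z, v). grad (\<lambda>u. smoothed f rx ry u y z v) x)"

definition G_y ::
  "('a::euclidean_space \<Rightarrow> 'b::euclidean_space \<Rightarrow> real) \<Rightarrow> real \<Rightarrow> real \<Rightarrow> 'a \<times> 'b \<times> 'a \<times> 'b \<Rightarrow> 'b" where
  "G_y f rx ry = (\<lambda>(x, y, z, v). - grad (\<lambda>w. smoothed f rx ry x w z v) y)"

text \<open>One step from the previous state \<open>p\<close> and the current state \<open>c\<close>;
  states are quadruples \<open>(x, y, z, v)\<close>.\<close>

definition ds_ogda_step ::
  "'a::euclidean_space set \<Rightarrow> 'b::euclidean_space set \<Rightarrow> ('a \<Rightarrow> 'b \<Rightarrow> real) \<Rightarrow>
   real \<Rightarrow> real \<Rightarrow> real \<Rightarrow> real \<Rightarrow> real \<Rightarrow> real \<Rightarrow>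
   'a \<times> 'b \<times> 'a \<times> 'b \<Rightarrow> 'a \<times> 'b \<times> 'a \<times> 'b \<Rightarrow> 'a \<times> 'b \<times> 'a \<times> 'b" where
  "ds_ogda_step X Y f rx ry \<eta>x \<eta>y \<beta>x \<beta>y p c = (case c of (x, y, z, v) \<Rightarrow>
     (closest_point X (x - \<eta>x *\<^sub>R G_x f rx ry c + \<eta>x *\<^sub>R (G_x f rx ry p - G_x f rx ry c)),
      closest_point Y (y - \<eta>y *\<^sub>R G_y f rx ry c + \<eta>y *\<^sub>R (G_y f rx ry p - G_y f rx ry c)),
      z + \<beta>x *\<^sub>R (x - z),
      v + \<beta>y *\<^sub>R (y - v)))"

text \<open>The pair of the states with indices \<open>t - 1\<close> and \<open>t\<close>.\<close>

primrec ds_ogda_pair ::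
  "'a::euclidean_space set \<Rightarrow> 'b::euclidean_space set \<Rightarrow> ('a \<Rightarrow> 'b \<Rightarrow> real) \<Rightarrow>
   real \<Rightarrow> real \<Rightarrow> real \<Rightarrow> real \<Rightarrow> real \<Rightarrow> real \<Rightarrow> 'a \<Rightarrow> 'b \<Rightarrow>
   nat \<Rightarrow> ('a \<times> 'b \<times> 'a \<times> 'b) \<times> ('a \<times> 'b \<times> 'a \<times> 'b)" where
  "ds_ogda_pair X Y f rx ry \<eta>x \<eta>y \<beta>x \<beta>y x0 y0 0 = ((x0, y0, x0, y0), (x0, y0, x0, y0))"
| "ds_ogda_pair X Y f rx ry \<eta>x \<eta>y \<beta>x \<beta>y x0 y0 (Suc t) =
     (case ds_ogda_pair X Y f rx ry \<eta>x \<eta>y \<beta>x \<beta>y x0 y0 t of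
        (p, c) \<Rightarrow> (c, ds_ogda_step X Y f rx ry \<eta>x \<eta>y \<beta>x \<beta>y p c))"

definition ds_ogda ::
  "'a::euclidean_space set \<Rightarrow> 'b::euclidean_space set \<Rightarrow> ('a \<Rightarrow> 'b \<Rightarrow> real) \<Rightarrow>
   real \<Rightarrow> real \<Rightarrow> real \<Rightarrow> real \<Rightarrow> real \<Rightarrow> real \<Rightarrow> 'a \<Rightarrow> 'b \<Rightarrow>
   nat \<Rightarrow> 'a \<times> 'b \<times> 'a \<times> 'b" where
  "ds_ogda X Y f rx ry \<eta>x \<eta>y \<beta>x \<beta>y x0 y0 t =
     snd (ds_ogda_pair X Y f rx ry \<eta>x \<eta>y \<beta>x \<beta>y x0 y0 t)"

end

theory Submission
  imports Defs
begin

text \<open>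
  Put \<open>u = (x, y)\<close>, \<open>w = (z, v)\<close>, \<open>r\<^sub>x = r\<^sub>y = 4 L\<close>. For a frozen anchor \<open>w\<close> the
  smoothed game is strongly convex-concave, and its saddle point \<open>u\<^sup>*(w)\<close> solves a strongly monotone
  variational inequality on \<open>X \<times> Y\<close> and is Lipschitz in \<open>w\<close>. For small step sizes an optimistic step
  contracts the distance to \<open>u\<^sup>*(w)\<close> up to the movement of the anchor, so that the anchor essentially
  performs gradient descent-ascent on the saddle value \<open>p(z, v)\<close>.

  With the Moreau envelope \<open>P(z) = min\<^sub>x (max\<^sub>y f(x, y) + 2 L |x - z|\<^sup>2)\<close>, the potential \<open>2 P(z) - p(z, v)\<close>
  plus the tracking error decreases at each step by a multiple of
  \<open>\<beta>\<^sub>x |x\<^sup>* - z|\<^sup>2 + |y\<^sup>* - v|\<^sup>2\<close>, except for a term of order \<open>\<beta>\<^sub>x |x\<^sup>* - prox(z)|\<^sup>2\<close>. Strong convexity bounds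
  the latter by \<open>\<beta>\<^sub>x\<close> times the dual gap \<open>max\<^sub>y f(x\<^sup>*, y) - f(x\<^sup>*, y\<^sup>*)\<close>, and the gap is at most of order
  \<open>|y\<^sup>* - v|\<close> to the power \<open>1 / \<theta>\<close> under the KL property, and with \<open>\<theta> = 1\<close> in the concave case. Hence both
  cases are instances of one argument: \<open>\<beta>\<^sub>x\<close> is chosen such that the bad term is absorbed up to
  \<open>O(1 / T)\<close>, and summing over \<open>t < T\<close> yields a good index.
\<close>

section \<open>Gradients and first-order inequalities on convex sets\<close>

lemma GDERIV_grad:
  fixes g :: "'a::euclidean_space \<Rightarrow> real"
  assumes "g differentiable (at a)"
  shows "GDERIV g a :> grad g a"
proof -
  obtain g' where g': "(g has_derivative g') (at a)"
    using assms differentiable_def by blast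
  then have "linear g'"
    by (rule has_derivative_linear)
  \<comment> \<open>\<open>grad\<close> is a definite description, so a representing vector must be
    exhibited and shown unique; the adjoint evaluated at 1 is the Riesz representative of the
    derivative.\<close>
  then have "g' h = h \<bullet> adjoint g' 1" for h
    by (simp add: adjoint_works)
  with g' have D: "GDERIV g a :> adjoint g' 1"
    unfolding gderiv_def by (metis (no_types, lifting) ext)
  have "D = adjoint g' 1" if "GDERIV g a :> D" for D
    using has_derivative_unique[OF that[unfolded gderiv_def] D[unfolded gderiv_def]]
    by (metis vector_eq_ldot)
  with D show ?thesis
    unfolding grad_def by (rule theI)
qed

lemma grad_eqI:
  fixes g :: "'a::euclidean_space \<Rightarrow> real"
  assumes "GDERIV g a :> D"
  shows "grad g a = D"
proof -
  have "g differentiable (at a)"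
    using assms unfolding gderiv_def differentiable_def by blast
  then have "GDERIV g a :> grad g a"
    by (rule GDERIV_grad)
  from has_derivative_unique[OF this[unfolded gderiv_def] assms[unfolded gderiv_def]]
  show ?thesis
    by (metis vector_eq_ldot)
qed

lemma GDERIV_along_line:
  fixes h :: "'a::euclidean_space \<Rightarrow> real"
  assumes "GDERIV h (a + t *\<^sub>R d) :> D"
  shows "((\<lambda>t. h (a + t *\<^sub>R d)) has_real_derivative d \<bullet> D) (at t)"
proof -
  have "((\<lambda>t. a + t *\<^sub>R d) has_derivative (\<lambda>s. s *\<^sub>R d)) (at t)"
    by (auto intro!: derivative_eq_intros)
  from has_derivative_compose[OF this assms[unfolded gderiv_def]]
  show ?thesis
    by (simp add: has_field_derivative_def mult_commute_abs)
qed

lemma lipschitz_gradient_lower_bound: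
  fixes h :: "'a::euclidean_space \<Rightarrow> real"
  assumes der: "\<And>a. GDERIV h a :> G a"
    and S: "convex S" "a \<in> S" "b \<in> S"
    and lip: "\<And>a b. a \<in> S \<Longrightarrow> b \<in> S \<Longrightarrow> norm (G a - G b) \<le> L * norm (a - b)"
  shows "h b \<ge> h a + G a \<bullet> (b - a) - L / 2 * (norm (b - a))\<^sup>2"
proof -
  define d where "d = b - a"
  \<comment> \<open>The claim is \<open>k 0 \<le> k 1\<close>; the quadratic term is the slack with
    which the Lipschitz bound along the segment makes the derivative nonnegative.\<close>
  define k where "k t = h (a + t *\<^sub>R d) - t * (G a \<bullet> d) + L / 2 * t\<^sup>2 * (norm d)\<^sup>2" for t
  have kd: "(k has_real_derivative d \<bullet> G (a + t *\<^sub>R d) - G a \<bullet> d + L * t * (norm d)\<^sup>2) (at t)" for t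
    unfolding k_def
    by (auto intro!: derivative_eq_intros GDERIV_along_line der)
  have "0 \<le> d \<bullet> G (a + t *\<^sub>R d) - G a \<bullet> d + L * t * (norm d)\<^sup>2" if "0 \<le> t" "t \<le> 1" for t
  proof -
    have eq: "a + t *\<^sub>R d = (1 - t) *\<^sub>R a + t *\<^sub>R b"
      by (simp add: d_def algebra_simps)
    have mem: "a + t *\<^sub>R d \<in> S"
      unfolding eq using S that by (intro convexD) auto
    have "\<bar>d \<bullet> (G (a + t *\<^sub>R d) - G a)\<bar> \<le> norm d * norm (G (a + t *\<^sub>R d) - G a)"
      by (rule Cauchy_Schwarz_ineq2)
    also have "\<dots> \<le> norm d * (L * norm (t *\<^sub>R d))"
      using lip[OF mem S(2)] by (intro mult_left_mono) auto
    also have "\<dots> = L * t * (norm d)\<^sup>2"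
      using that by (simp add: power2_eq_square)
    finally show ?thesis
      by (simp add: inner_diff_right inner_commute abs_le_iff)
  qed
  then have "k 0 \<le> k 1"
    by (intro DERIV_nonneg_imp_nondecreasing[of 0 1 k]) (use kd in auto)
  then show ?thesis
    by (simp add: k_def d_def)
qed

text \<open>Expand at the convex combination towards both end points: the weighted linear terms
  cancel, and the squares combine through (1 - t)t^2 + t(1 - t)^2 = t(1 - t).\<close>

lemma convex_quadratic_from_lower_bound:
  fixes h :: "'a::real_inner \<Rightarrow> real"
  assumes lb: "\<And>a b. a \<in> S \<Longrightarrow> b \<in> S \<Longrightarrow> h b \<ge> h a + G a \<bullet> (b - a) - L / 2 * (norm (b - a))\<^sup>2"
    and S: "convex S" "a \<in> S" "b \<in> S" and t: "0 \<le> t" "t \<le> 1"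
  shows "h ((1 - t) *\<^sub>R a + t *\<^sub>R b) \<le> (1 - t) * h a + t * h b + L / 2 * t * (1 - t) * (norm (b - a))\<^sup>2"
proof -
  define c where "c = (1 - t) *\<^sub>R a + t *\<^sub>R b"
  have c: "c \<in> S"
    unfolding c_def using S t by (intro convexD) auto
  have ac: "a - c = t *\<^sub>R (a - b)" and bc: "b - c = (1 - t) *\<^sub>R (b - a)"
    by (auto simp: c_def algebra_simps)
  have "(1 - t) * h a \<ge> (1 - t) * (h c + G c \<bullet> (a - c) - L / 2 * (norm (a - c))\<^sup>2)"
    using lb[OF c S(2)] t by (intro mult_left_mono) auto
  moreover have "t * h b \<ge> t * (h c + G c \<bullet> (b - c) - L / 2 * (norm (b - c))\<^sup>2)"
    using lb[OF c S(3)] t by (intro mult_left_mono) auto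
  moreover have "(1 - t) * (h c + G c \<bullet> (a - c) - L / 2 * (norm (a - c))\<^sup>2)
      + t * (h c + G c \<bullet> (b - c) - L / 2 * (norm (b - c))\<^sup>2)
      = h c - L / 2 * t * (1 - t) * (norm (b - a))\<^sup>2"
    unfolding ac bc
    by (simp add: power_mult_distrib norm_minus_commute[of a b] inner_diff_right)
      (simp add: field_simps power2_eq_square)
  ultimately show ?thesis
    unfolding c_def[symmetric] by linarith
qed

text \<open>By concavity every difference quotient on the segment is at least
  \<open>h b - h a\<close>; the quotient tends to the derivative as the step shrinks.\<close>

lemma concave_on_above_tangent:
  fixes h :: "'a::euclidean_space \<Rightarrow> real"
  assumes conc: "concave_on S h" and S: "a \<in> S" "b \<in> S" and der: "GDERIV h a :> D"
  shows "h b - h a \<le> D \<bullet> (b - a)"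
proof -
  have "((\<lambda>t. h (a + t *\<^sub>R (b - a))) has_real_derivative (b - a) \<bullet> D) (at 0)"
    by (rule GDERIV_along_line) (use der in simp)
  then have lim: "((\<lambda>t. (h (a + t *\<^sub>R (b - a)) - h a) / t) \<longlongrightarrow> (b - a) \<bullet> D) (at_right 0)"
    unfolding has_field_derivative_iff
    by (auto intro: tendsto_within_subset)
  have "h b - h a \<le> (h (a + t *\<^sub>R (b - a)) - h a) / t" if "0 < t" "t < 1" for t
  proof -
    have "- h ((1 - t) *\<^sub>R a + t *\<^sub>R b) \<le> (1 - t) * - h a + t * - h b"
      using conc S that unfolding concave_on_def by (intro convex_onD) auto
    moreover have "(1 - t) *\<^sub>R a + t *\<^sub>R b = a + t *\<^sub>R (b - a)"
      by (simp add: algebra_simps)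
    ultimately show ?thesis
      using that by (simp add: field_simps)
  qed
  then have "\<forall>\<^sub>F t in at_right 0. h b - h a \<le> (h (a + t *\<^sub>R (b - a)) - h a) / t"
    using eventually_at_right_less[of "0::real"] eventually_at_right_real[of 0 1]
    by (auto elim: eventually_mono)
  from tendsto_lowerbound[OF lim this] show ?thesis
    by (simp add: inner_commute)
qed

lemma convex_step_in:
  fixes S :: "'a::real_vector set"
  assumes "convex S" "a \<in> S" "b \<in> S" "0 \<le> t" "t \<le> 1"
  shows "a + t *\<^sub>R (b - a) \<in> S"
  using convexD_alt[OF assms] by (simp add: algebra_simps)

text \<open>Strong convexity against minimality leaves, after division by t, the bound with an extra
  factor 1 - t, which disappears as t tends to 0. Only the segment is tested, which suits minimizers
  over convex sets.\<close>

lemma strongly_convex_minimizer: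
  fixes h :: "'a::real_inner \<Rightarrow> real"
  assumes sc: "\<And>t. 0 < t \<Longrightarrow> t < 1 \<Longrightarrow>
      h ((1 - t) *\<^sub>R a + t *\<^sub>R b) \<le> (1 - t) * h a + t * h b - \<mu> / 2 * t * (1 - t) * (norm (b - a))\<^sup>2"
    and min: "\<And>t. 0 < t \<Longrightarrow> t < 1 \<Longrightarrow> h a \<le> h ((1 - t) *\<^sub>R a + t *\<^sub>R b)"
  shows "h b \<ge> h a + \<mu> / 2 * (norm (b - a))\<^sup>2"
proof -
  define B where "B = \<mu> / 2 * (norm (b - a))\<^sup>2"
  have "(1 - t) * B \<le> h b - h a" if "0 < t" "t < 1" for t
  proof -
    have "0 \<le> t * (h b - h a - (1 - t) * B)"
      using sc[OF that] min[OF that] by (simp add: B_def algebra_simps)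
    with that show ?thesis
      by (simp add: zero_le_mult_iff)
  qed
  then have "\<forall>\<^sub>F t in at_right 0. (1 - t) * B \<le> h b - h a"
    using eventually_at_right_real[of 0 1] by (auto elim: eventually_mono)
  moreover have "((\<lambda>t. (1 - t) * B) \<longlongrightarrow> (1 - 0) * B) (at_right 0)"
    by (intro tendsto_intros)
  ultimately have "(1 - 0) * B \<le> h b - h a"
    by (intro tendsto_upperbound) auto
  then show ?thesis
    by (simp add: B_def)
qed

section \<open>Components of a state and elementary inequalities\<close>

abbreviation primal_dual :: "'a \<times> 'b \<times> 'a \<times> 'b \<Rightarrow> 'a \<times> 'b" where
  "primal_dual s \<equiv> (fst s, fst (snd s))"

abbreviation anchor :: "'a \<times> 'b \<times> 'a \<times> 'b \<Rightarrow> 'a \<times> 'b" where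
  "anchor s \<equiv> snd (snd s)"

lemma GDERIV_norm_diff_square:
  fixes z :: "'a::euclidean_space"
  shows "GDERIV (\<lambda>u. r / 2 * (norm (u - z))\<^sup>2) x :> r *\<^sub>R (x - z)"
  unfolding gderiv_def power2_norm_eq_inner
  by (auto intro!: derivative_eq_intros simp: inner_commute)

text \<open>The anchor moves towards the iterate \<open>x\<close>, while the potential measures the
  saddle component \<open>x'\<close>. Polarization gives half of |x - x'|^2 - |x - z|^2 - |x' -
  z|^2, and the middle square is dropped.\<close>

lemma tracked_step_inner:
  fixes x x' z :: "'a::real_inner"
  assumes "\<beta> \<ge> 0"
  shows "\<beta> *\<^sub>R (x - z) \<bullet> (z - x') \<le> \<beta> * (- (norm (x' - z))\<^sup>2 / 2 + (norm (x - x'))\<^sup>2 / 2)"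
proof -
  have "(norm (x - z))\<^sup>2 = (norm (x - x'))\<^sup>2 + (norm (x' - z))\<^sup>2 + 2 * ((x - x') \<bullet> (x' - z))"
    unfolding power2_norm_eq_inner by (simp add: inner_simps inner_commute)
  moreover have "(x - z) \<bullet> (z - x') = - (norm (x' - z))\<^sup>2 - (x - x') \<bullet> (x' - z)"
    unfolding power2_norm_eq_inner by (simp add: inner_simps inner_commute)
  moreover have "0 \<le> (norm (x - z))\<^sup>2"
    by simp
  ultimately have "(x - z) \<bullet> (z - x') \<le> - (norm (x' - z))\<^sup>2 / 2 + (norm (x - x'))\<^sup>2 / 2"
    by linarith
  with assms show ?thesis
    by (simp add: mult_left_mono)
qed

lemma norm_diff_square_le:
  fixes x x' z :: "'a::real_inner"
  shows "(norm (x - z))\<^sup>2 \<le> 2 * (norm (x - x'))\<^sup>2 + 2 * (norm (x' - z))\<^sup>2"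
proof -
  have "2 * (norm (x - x'))\<^sup>2 + 2 * (norm (x' - z))\<^sup>2 - (norm (x - z))\<^sup>2 = (norm ((x - x') - (x' - z)))\<^sup>2"
    unfolding power2_norm_eq_inner by (simp add: inner_simps inner_commute)
  then show ?thesis
    by (metis diff_ge_0_iff_ge zero_le_power2)
qed

text \<open>Telescoping: T errors of size C / T cost C in total, so the decrements cannot all exceed
  the average of the available drop.\<close>

lemma exists_small_decrement:
  fixes \<Psi> d :: "nat \<Rightarrow> real"
  assumes T: "T > 0" and step: "\<And>t. \<Psi> (Suc t) \<le> \<Psi> t - d t + C / real T" and low: "m \<le> \<Psi> T"
  shows "\<exists>t<T. d t \<le> (\<Psi> 0 - m + C) / real T"
proof (rule ccontr)
  assume "\<not> ?thesis"
  then have big: "(\<Psi> 0 - m + C) / real T < d t" if "t < T" for t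
    using that by force
  have "\<Psi> n \<le> \<Psi> 0 - (\<Sum>t<n. d t) + real n * (C / real T)" for n
  proof (induction n)
    case (Suc n)
    with step[of n] show ?case
      by (simp add: algebra_simps add_divide_distrib)
  qed simp
  from this[of T] have "(\<Sum>t<T. d t) \<le> \<Psi> 0 - m + C"
    using T low by simp
  moreover have "(\<Sum>t<T. (\<Psi> 0 - m + C) / real T) < (\<Sum>t<T. d t)"
    using T big by (intro sum_strict_mono) auto
  ultimately show False
    using T by simp
qed

lemma game_stationary_mono:
  "game_stationary X Y f \<epsilon> x y \<Longrightarrow> \<epsilon> \<le> \<epsilon>' \<Longrightarrow> game_stationary X Y f \<epsilon>' x y"
  unfolding game_stationary_def by linarith

text \<open>Source of the exponent \<alpha> = (2\<theta> - 1)_+ / (2\<theta>) of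
  \<open>\<beta>x\<close>: the factor T^(-\<alpha>) trades s^(1/\<theta>), which decays too slowly
  when \<theta> > 1/2, for a multiple of s^2 plus an error 1 / T whose sum over T steps is
  bounded.\<close>

lemma powr_rate_bound:
  fixes \<theta> D :: real
  assumes \<theta>: "0 < \<theta>" and D: "0 \<le> D"
  obtains K where "K \<ge> 0"
    and "\<And>T s. 1 < T \<Longrightarrow> 0 \<le> s \<Longrightarrow> s \<le> D \<Longrightarrow>
      real T powr (- (max (2 * \<theta> - 1) 0 / (2 * \<theta>))) * s powr (1 / \<theta>) \<le> K * (s\<^sup>2 + 1 / real T)"
proof (cases "\<theta> \<le> 1 / 2")
  case True
  \<comment> \<open>Here \<alpha> = 0 and 1/\<theta> - 2 is nonnegative, so the surplus power of s
    is bounded through \<open>s \<le> D\<close>.\<close>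
  have "s powr (1 / \<theta>) \<le> D powr (1 / \<theta> - 2) * (s\<^sup>2 + 1 / real T)" if "0 \<le> s" "s \<le> D" for s and T :: nat
  proof (cases "s = 0")
    case False
    then have "s powr (1 / \<theta>) = s powr (1 / \<theta> - 2) * s\<^sup>2"
      using that by (simp add: powr_diff flip: powr_numeral)
    also have "\<dots> \<le> D powr (1 / \<theta> - 2) * (s\<^sup>2 + 1 / real T)"
      using True \<theta> that by (intro mult_mono powr_mono2) (auto simp: field_simps)
    finally show ?thesis .
  qed auto
  then show ?thesis
    using True by (intro that[of "D powr (1 / \<theta> - 2)"]) (auto simp: max_def)
next
  case False
  define \<alpha> where "\<alpha> = max (2 * \<theta> - 1) 0 / (2 * \<theta>)"
  have \<alpha>: "1 / \<theta> = 2 - 2 * \<alpha>"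
    using False \<theta> by (simp add: \<alpha>_def max_def field_simps)
  have \<alpha>0: "0 \<le> \<alpha>" "\<alpha> < 1"
    using \<theta> unfolding \<alpha>_def by (auto simp: max_def field_simps)
  \<comment> \<open>Now 1/\<theta> = 2 - 2\<alpha>. The terms on the right balance at s^2 = 1 / T:
    above this threshold s^(-2\<alpha>) is at most T^\<alpha>, below it s^(1/\<theta>) is at most
    T^(\<alpha> - 1).\<close>
  have "real T powr (- \<alpha>) * s powr (1 / \<theta>) \<le> s\<^sup>2 + 1 / real T" if T: "1 < T" and s: "0 \<le> s" for s and T :: nat
  proof (cases "1 / real T \<le> s\<^sup>2")
    case True
    then have sp: "s > 0"
      using T s by (cases "s = 0") auto
    have "s powr (1 / \<theta>) = s\<^sup>2 * s\<^sup>2 powr (- \<alpha>)"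
      using sp by (simp add: \<alpha> powr_add[symmetric] powr_powr flip: powr_numeral)
    also have "\<dots> \<le> s\<^sup>2 * (1 / real T) powr (- \<alpha>)"
      using True T \<alpha>0 by (intro mult_left_mono powr_mono2') auto
    also have "(1 / real T) powr (- \<alpha>) = real T powr \<alpha>"
      using T by (simp add: powr_minus powr_divide)
    finally have "real T powr (- \<alpha>) * s powr (1 / \<theta>) \<le> real T powr (- \<alpha>) * (s\<^sup>2 * real T powr \<alpha>)"
      by (intro mult_left_mono) auto
    also have "\<dots> = s\<^sup>2"
      using T by (simp add: powr_minus)
    finally show ?thesis
      using T by (simp add: add_increasing2)
  next
    case False
    have "s powr (1 / \<theta>) \<le> (sqrt (1 / real T)) powr (1 / \<theta>)"
      using False \<theta> s by (intro powr_mono2) (auto intro: real_le_rsqrt)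
    also have "\<dots> = (1 / real T) powr (1 - \<alpha>)"
      using T by (simp add: \<alpha> powr_half_sqrt[symmetric] powr_powr diff_divide_distrib)
    also have "\<dots> = real T powr (\<alpha> - 1)"
      using T by (simp add: powr_divide powr_diff)
    finally have "real T powr (- \<alpha>) * s powr (1 / \<theta>) \<le> real T powr (- \<alpha>) * real T powr (\<alpha> - 1)"
      by (intro mult_left_mono) auto
    also have "\<dots> = 1 / real T"
      using T by (simp add: powr_minus powr_diff)
    finally show ?thesis
      by (simp add: add_increasing)
  qed
  then show ?thesis
    by (intro that[of 1]) (auto simp: \<alpha>_def)
qed

section \<open>The max function and its proximal point\<close>

definition prox_objective :: "'b set \<Rightarrow> ('a::real_normed_vector \<Rightarrow> 'b \<Rightarrow> real) \<Rightarrow> real \<Rightarrow> 'a \<Rightarrow> 'a \<Rightarrow> real" where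
  "prox_objective Y f r z x = max_val Y f x + r / 2 * (norm (x - z))\<^sup>2"

locale minimax_problem =
  fixes X :: "'a::euclidean_space set" and Y :: "'b::euclidean_space set"
    and f :: "'a \<Rightarrow> 'b \<Rightarrow> real" and L :: real
  assumes Y: "Y \<noteq> {}" "compact Y" "convex Y"
    and X: "X \<noteq> {}" "closed X" "convex X"
    and differentiable: "cont_differentiable (\<lambda>(x, y). f x y)"
    and L: "L \<ge> 1" and lipschitz: "lipschitz_grads L X Y f"
begin

lemma GDERIV_x: "GDERIV (\<lambda>u. f u y) x :> grad_x f x y"
proof -
  have "(\<lambda>(x, y). f x y) differentiable (at (x, y))"
    using differentiable by (simp add: cont_differentiable_def)
  then obtain D where D: "((\<lambda>(x, y). f x y) has_derivative D) (at (x, y))"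
    by (auto simp: differentiable_def)
  have "((\<lambda>u. (u, y)) has_derivative (\<lambda>d. (d, 0))) (at x)"
    by (auto intro!: derivative_eq_intros)
  from has_derivative_compose[OF this D] have "(\<lambda>u. f u y) differentiable (at x)"
    by (auto simp: differentiable_def)
  then show ?thesis
    unfolding grad_x_def by (rule GDERIV_grad)
qed

lemma GDERIV_y: "GDERIV (\<lambda>w. f x w) y :> grad_y f x y"
proof -
  have "(\<lambda>(x, y). f x y) differentiable (at (x, y))"
    using differentiable by (simp add: cont_differentiable_def)
  then obtain D where D: "((\<lambda>(x, y). f x y) has_derivative D) (at (x, y))"
    by (auto simp: differentiable_def)
  have "((\<lambda>w. (x, w)) has_derivative (\<lambda>d. (0, d))) (at y)"
    by (auto intro!: derivative_eq_intros)
  from has_derivative_compose[OF this D] have "(\<lambda>w. f x w) differentiable (at y)"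
    by (auto simp: differentiable_def)
  then show ?thesis
    unfolding grad_y_def by (rule GDERIV_grad)
qed

lemma continuous_on_x: "continuous_on S (\<lambda>u. f u y)"
  using GDERIV_x[unfolded gderiv_def, THEN has_derivative_continuous]
  by (simp add: continuous_at_imp_continuous_on)

lemma continuous_on_y: "continuous_on S (\<lambda>w. f x w)"
  using GDERIV_y[unfolded gderiv_def, THEN has_derivative_continuous]
  by (simp add: continuous_at_imp_continuous_on)

lemma lower_bound_x:
  assumes "a \<in> X" "b \<in> X" "y \<in> Y"
  shows "f b y \<ge> f a y + grad_x f a y \<bullet> (b - a) - L / 2 * (norm (b - a))\<^sup>2"
proof (rule lipschitz_gradient_lower_bound[where S = X])
  show "norm (grad_x f a y - grad_x f b y) \<le> L * norm (a - b)" if "a \<in> X" "b \<in> X" for a b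
    using lipschitz that assms(3) unfolding lipschitz_grads_def by fastforce
qed (use assms X GDERIV_x in auto)

lemma upper_bound_y:
  assumes "a \<in> Y" "b \<in> Y" "x \<in> X"
  shows "f x b \<le> f x a + grad_y f x a \<bullet> (b - a) + L / 2 * (norm (b - a))\<^sup>2"
proof -
  have "- f x b \<ge> - f x a + (- grad_y f x a) \<bullet> (b - a) - L / 2 * (norm (b - a))\<^sup>2"
  proof (rule lipschitz_gradient_lower_bound[where S = Y and h = "\<lambda>w. - f x w" and G = "\<lambda>w. - grad_y f x w"])
    show "norm (- grad_y f x a - - grad_y f x b) \<le> L * norm (a - b)" if "a \<in> Y" "b \<in> Y" for a b
    proof -
      have "norm (grad_y f x a - grad_y f x b) \<le> L * norm (a - b)"
        using lipschitz that assms(3) unfolding lipschitz_grads_def by fastforce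
      then show ?thesis
        by (simp add: norm_minus_commute)
    qed
  qed (use assms Y GDERIV_y in \<open>auto intro!: GDERIV_minus\<close>)
  then show ?thesis
    by simp
qed

lemma max_val_ge: "y \<in> Y \<Longrightarrow> f x y \<le> max_val Y f x"
  unfolding max_val_def
  by (rule cSUP_upper)
    (use Y compact_imp_bounded[OF compact_continuous_image[OF continuous_on_y]] bounded_imp_bdd_above in auto)

lemma max_val_le: "(\<And>y. y \<in> Y \<Longrightarrow> f x y \<le> c) \<Longrightarrow> max_val Y f x \<le> c"
  unfolding max_val_def using Y by (intro cSUP_least) auto

text \<open>Lets convexity and closed sublevel sets pass from the functions with y fixed to their
  maximum.\<close>

lemma prox_objective_le_iff:
  "prox_objective Y f r z x \<le> c \<longleftrightarrow> (\<forall>y\<in>Y. f x y + r / 2 * (norm (x - z))\<^sup>2 \<le> c)"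
proof
  assume "prox_objective Y f r z x \<le> c"
  then show "\<forall>y\<in>Y. f x y + r / 2 * (norm (x - z))\<^sup>2 \<le> c"
    unfolding prox_objective_def by (meson add_right_mono max_val_ge order_trans)
next
  assume "\<forall>y\<in>Y. f x y + r / 2 * (norm (x - z))\<^sup>2 \<le> c"
  then have "max_val Y f x \<le> c - r / 2 * (norm (x - z))\<^sup>2"
    by (intro max_val_le) (auto simp: algebra_simps)
  then show "prox_objective Y f r z x \<le> c"
    by (simp add: prox_objective_def)
qed

text \<open>With y fixed, \<open>f\<close> lacks convexity by at most weight L, while the proximal
  square satisfies an exact identity with weight r. The estimate is uniform in y and survives the
  maximum.\<close>

lemma prox_objective_strongly_convex:
  assumes "a \<in> X" "b \<in> X" "0 \<le> t" "t \<le> 1"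
  shows "prox_objective Y f r z ((1 - t) *\<^sub>R a + t *\<^sub>R b) \<le>
    (1 - t) * prox_objective Y f r z a + t * prox_objective Y f r z b
      - (r - L) / 2 * t * (1 - t) * (norm (b - a))\<^sup>2"
proof -
  define c where "c = (1 - t) *\<^sub>R a + t *\<^sub>R b"
  have c: "c \<in> X"
    unfolding c_def using assms X by (intro convexD) auto
  have sq: "(norm (c - z))\<^sup>2 = (1 - t) * (norm (a - z))\<^sup>2 + t * (norm (b - z))\<^sup>2 - t * (1 - t) * (norm (b - a))\<^sup>2"
    unfolding c_def power2_norm_eq_inner
    by (simp add: inner_simps inner_commute) (simp add: algebra_simps)
  have "f c y + r / 2 * (norm (c - z))\<^sup>2 \<le> (1 - t) * prox_objective Y f r z a + t * prox_objective Y f r z b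
      - (r - L) / 2 * t * (1 - t) * (norm (b - a))\<^sup>2" if y: "y \<in> Y" for y
  proof -
    have "f c y \<le> (1 - t) * f a y + t * f b y + L / 2 * t * (1 - t) * (norm (b - a))\<^sup>2"
      unfolding c_def
      by (rule convex_quadratic_from_lower_bound[where S = X and G = "\<lambda>a. grad_x f a y" and h = "\<lambda>x. f x y"])
        (use assms y X lower_bound_x in auto)
    also have "\<dots> \<le> (1 - t) * max_val Y f a + t * max_val Y f b + L / 2 * t * (1 - t) * (norm (b - a))\<^sup>2"
      using assms y max_val_ge by (intro add_right_mono add_mono mult_left_mono) auto
    finally show ?thesis
      unfolding sq prox_objective_def by (simp add: field_simps)
  qed
  then show ?thesis
    unfolding c_def[symmetric] prox_objective_le_iff by blast
qed

text \<open>The sublevel sets \<open>F n\<close> are closed as intersections over y, and bounded by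
  the quadratic term together with the lower bound of \<open>max_val\<close>; nested nonempty
  compact sets have a common point.\<close>

lemma prox_objective_attains_min:
  assumes bdd: "bdd_below (max_val Y f ` X)" and r: "r > 0"
  shows "\<exists>a\<in>X. \<forall>b\<in>X. prox_objective Y f r z a \<le> prox_objective Y f r z b"
proof -
  let ?h = "prox_objective Y f r z"
  obtain l where l: "\<And>x. x \<in> X \<Longrightarrow> l \<le> max_val Y f x"
    using bdd by (auto simp: bdd_below_def)
  have hl: "l + r / 2 * (norm (x - z))\<^sup>2 \<le> ?h x" if "x \<in> X" for x
    using l[OF that] by (simp add: prox_objective_def)
  have hl': "l \<le> ?h x" if "x \<in> X" for x
    using hl[OF that] r by (smt (verit) divide_nonneg_nonneg mult_nonneg_nonneg zero_le_power2)
  define m where "m = Inf (?h ` X)"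
  have bddh: "bdd_below (?h ` X)"
    using hl' by (auto simp: bdd_below_def)
  define F where "F n = {x \<in> X. ?h x \<le> m + 1 / real (Suc n)}" for n
  have "\<Inter>(range F) \<noteq> {}"
  proof (rule compact_nest)
    fix n
    have F_eq: "F n = X \<inter> (\<Inter>y\<in>Y. {x. f x y + r / 2 * (norm (x - z))\<^sup>2 \<le> m + 1 / real (Suc n)})"
      unfolding F_def prox_objective_le_iff by auto
    have "closed {x. f x y + r / 2 * (norm (x - z))\<^sup>2 \<le> m + 1 / real (Suc n)}" for y
      by (intro closed_Collect_le continuous_intros continuous_on_x)
    then have "closed (F n)"
      unfolding F_eq by (intro closed_Int X(2) closed_INT ballI)
    moreover have "F n \<subseteq> cball z (sqrt (2 * (m + 1 / real (Suc n) - l) / r))"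
    proof
      fix x assume "x \<in> F n"
      then have "l + r / 2 * (norm (x - z))\<^sup>2 \<le> m + 1 / real (Suc n)"
        using hl unfolding F_def by force
      then have "(norm (x - z))\<^sup>2 * r \<le> 2 * (m + 1 / real (Suc n) - l)"
        by (simp add: algebra_simps)
      then have "(norm (x - z))\<^sup>2 \<le> 2 * (m + 1 / real (Suc n) - l) / r"
        using pos_le_divide_eq[OF r] by blast
      then show "x \<in> cball z (sqrt (2 * (m + 1 / real (Suc n) - l) / r))"
        using real_le_rsqrt by (auto simp: dist_norm norm_minus_commute)
    qed
    ultimately show "compact (F n)"
      using bounded_subset[OF bounded_cball] compact_eq_bounded_closed by blast
    have "\<exists>v\<in>?h ` X. v < m + 1 / real (Suc n)"
      unfolding m_def by (rule cInf_lessD) (use X in auto)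
    then show "F n \<noteq> {}"
      unfolding F_def by force
  next
    fix i j :: nat assume "i \<le> j"
    then have "1 / real (Suc j) \<le> 1 / real (Suc i)"
      by (simp add: frac_le)
    then show "F j \<subseteq> F i"
      unfolding F_def by auto
  qed
  then obtain a where a: "\<And>n. a \<in> F n"
    by blast
  have "?h a \<le> m"
  proof (rule field_le_epsilon)
    fix e :: real assume "e > 0"
    then obtain n where "1 / real (Suc n) < e"
      using nat_approx_posE by metis
    with a[of n] show "?h a \<le> m + e"
      unfolding F_def by auto
  qed
  moreover have "m \<le> ?h b" if "b \<in> X" for b
    unfolding m_def using bddh that by (intro cInf_lower) auto
  ultimately show ?thesis
    using a[of 0] unfolding F_def by force
qed

text \<open>The extended-valued objective behind \<open>prox\<close> equals
  \<open>prox_objective\<close> on X and is infinite elsewhere. Attainment makes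
  \<open>arg_min\<close> a genuine minimizer, and strong convexity on segments inside X gives
  quadratic growth.\<close>

lemma prox_min:
  fixes z :: 'a
  assumes bdd: "bdd_below (max_val Y f ` X)" and r: "r > L"
  defines "p \<equiv> prox (primal_fun X Y f) r z"
  shows prox_in: "p \<in> X"
    and prox_objective_growth:
      "b \<in> X \<Longrightarrow> prox_objective Y f r z b \<ge> prox_objective Y f r z p + (r - L) / 2 * (norm (b - p))\<^sup>2"
proof -
  let ?h = "\<lambda>u. primal_fun X Y f u + ereal (r / 2 * (norm (u - z))\<^sup>2)"
  have h: "?h u = (if u \<in> X then ereal (prox_objective Y f r z u) else \<infinity>)" for u
    by (simp add: primal_fun_def indicator_fun_def prox_objective_def)
  have "0 < r"
    using r L by simp
  from prox_objective_attains_min[OF bdd this] obtain a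
    where a: "a \<in> X" "\<And>b. b \<in> X \<Longrightarrow> prox_objective Y f r z a \<le> prox_objective Y f r z b"
    by blast
  have "\<forall>v. ?h p \<le> ?h v"
    unfolding p_def prox_def
  proof (rule arg_minI)
    show "\<not> ?h y < ?h a" for y
      unfolding h using a by (auto simp: not_less)
  qed (auto simp: not_less)
  then have p: "?h p \<le> ?h v" for v
    by blast
  show pX: "p \<in> X"
    using p[of a] a(1) unfolding h by (auto split: if_splits)
  have pm: "prox_objective Y f r z p \<le> prox_objective Y f r z b" if "b \<in> X" for b
    using p[of b] that pX unfolding h by auto
  show "prox_objective Y f r z b \<ge> prox_objective Y f r z p + (r - L) / 2 * (norm (b - p))\<^sup>2" if "b \<in> X"
  proof (rule strongly_convex_minimizer)
    fix t :: real assume t: "0 < t" "t < 1"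
    show "prox_objective Y f r z ((1 - t) *\<^sub>R p + t *\<^sub>R b) \<le>
        (1 - t) * prox_objective Y f r z p + t * prox_objective Y f r z b
          - (r - L) / 2 * t * (1 - t) * (norm (b - p))\<^sup>2"
      using prox_objective_strongly_convex[OF pX that] t by simp
    show "prox_objective Y f r z p \<le> prox_objective Y f r z ((1 - t) *\<^sub>R p + t *\<^sub>R b)"
      using t pX that X by (intro pm convexD) auto
  qed
qed

section \<open>Saddle points of the smoothed game\<close>

definition saddle_field :: "'a \<times> 'b \<Rightarrow> 'a \<times> 'b" where
  "saddle_field u = (grad_x f (fst u) (snd u), - grad_y f (fst u) (snd u))"

text \<open>The factor 2 comes from passing between sums of norms and the Euclidean norm of pairs:
  (p + q)^2 \<le> 2(p^2 + q^2), applied to each of the two gradient components.\<close>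

lemma saddle_field_lipschitz:
  assumes "u \<in> X \<times> Y" "u' \<in> X \<times> Y"
  shows "norm (saddle_field u - saddle_field u') \<le> 2 * L * norm (u - u')"
proof -
  obtain x y x' y' where u: "u = (x, y)" "u' = (x', y')"
    by (cases u, cases u')
  define p q where "p = norm (x - x')" and "q = norm (y - y')"
  define P Q where "P = norm (grad_x f x y - grad_x f x' y')" and "Q = norm (grad_y f x y - grad_y f x' y')"
  have "P \<le> L * (p + q)" "Q \<le> L * (p + q)"
    using lipschitz assms unfolding lipschitz_grads_def u P_def Q_def p_def q_def by auto
  then have "P\<^sup>2 \<le> (L * (p + q))\<^sup>2" "Q\<^sup>2 \<le> (L * (p + q))\<^sup>2"
    unfolding P_def Q_def by (auto intro: power_mono)
  moreover have "(L * (p + q))\<^sup>2 \<le> L\<^sup>2 * (2 * p\<^sup>2 + 2 * q\<^sup>2)"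
    using zero_le_power2[of "p - q"]
    by (simp add: power_mult_distrib power2_sum power2_diff mult_left_mono)
  ultimately have "P\<^sup>2 + Q\<^sup>2 \<le> (2 * L)\<^sup>2 * (p\<^sup>2 + q\<^sup>2)"
    by (simp add: algebra_simps)
  then have "sqrt (P\<^sup>2 + Q\<^sup>2) \<le> sqrt ((2 * L)\<^sup>2 * (p\<^sup>2 + q\<^sup>2))"
    by (rule real_sqrt_le_mono)
  also have "\<dots> = 2 * L * sqrt (p\<^sup>2 + q\<^sup>2)"
    using L by (simp add: real_sqrt_mult)
  finally show ?thesis
    by (simp add: u saddle_field_def norm_Pair P_def Q_def p_def q_def norm_minus_commute
        flip: norm_minus_cancel[of "- grad_y f x y + grad_y f x' y'"])
qed

lemma feasible_closed: "closed (X \<times> Y)"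
  and feasible_convex: "convex (X \<times> Y)"
  and feasible_nonempty: "X \<times> Y \<noteq> {}"
  using X Y by (auto intro: closed_Times convex_Times compact_imp_closed)

text \<open>The weight \<open>4 L\<close> is twice the Lipschitz constant of \<open>saddle_field\<close>, so that
  \<open>u \<mapsto> proj (w - saddle_field u / (4 L))\<close> is a contraction with factor \<open>1 / 2\<close>.\<close>

definition regularized_field :: "'a \<times> 'b \<Rightarrow> 'a \<times> 'b \<Rightarrow> 'a \<times> 'b" where
  "regularized_field w u = saddle_field u + (4 * L) *\<^sub>R (u - w)"

lemma regularized_field_strongly_monotone:
  assumes "u \<in> X \<times> Y" "u' \<in> X \<times> Y"
  shows "(regularized_field w u - regularized_field w u') \<bullet> (u - u') \<ge> 2 * L * (norm (u - u'))\<^sup>2"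
proof -
  have "\<bar>(saddle_field u - saddle_field u') \<bullet> (u - u')\<bar>
      \<le> norm (saddle_field u - saddle_field u') * norm (u - u')"
    by (rule Cauchy_Schwarz_ineq2)
  also have "\<dots> \<le> 2 * L * norm (u - u') * norm (u - u')"
    using saddle_field_lipschitz[OF assms] by (intro mult_right_mono) auto
  finally have "(saddle_field u - saddle_field u') \<bullet> (u - u') \<ge> - (2 * L * (norm (u - u'))\<^sup>2)"
    by (simp add: power2_eq_square)
  moreover have "regularized_field w u - regularized_field w u'
      = (saddle_field u - saddle_field u') + (4 * L) *\<^sub>R (u - u')"
    by (simp add: regularized_field_def algebra_simps)
  ultimately show ?thesis
    by (simp add: inner_add_left power2_norm_eq_inner)
qed

lemma regularized_field_lipschitz:
  assumes "u \<in> X \<times> Y" "u' \<in> X \<times> Y"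
  shows "norm (regularized_field w u - regularized_field w' u')
    \<le> 6 * L * norm (u - u') + 4 * L * norm (w - w')"
proof -
  have "regularized_field w u - regularized_field w' u'
      = (saddle_field u - saddle_field u') + ((4 * L) *\<^sub>R (u - u') - (4 * L) *\<^sub>R (w - w'))"
    by (simp add: regularized_field_def algebra_simps)
  also have "norm \<dots> \<le> norm (saddle_field u - saddle_field u')
      + (norm ((4 * L) *\<^sub>R (u - u')) + norm ((4 * L) *\<^sub>R (w - w')))"
    by (intro order_trans[OF norm_triangle_ineq] add_left_mono norm_triangle_ineq4)
  also have "\<dots> \<le> 2 * L * norm (u - u') + (4 * L * norm (u - u') + 4 * L * norm (w - w'))"
    using saddle_field_lipschitz[OF assms] L by simp
  finally show ?thesis
    by (simp add: algebra_simps)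
qed

text \<open>First-order optimality in both variables at once, as a variational inequality; the
  min-max inequalities follow in \<open>saddle_value_le_x\<close> and
  \<open>saddle_value_ge_y\<close>.\<close>

definition is_saddle :: "'a \<times> 'b \<Rightarrow> 'a \<times> 'b \<Rightarrow> bool" where
  "is_saddle w u \<longleftrightarrow> u \<in> X \<times> Y \<and> (\<forall>u'\<in>X \<times> Y. regularized_field w u \<bullet> (u' - u) \<ge> 0)"

lemma saddle_exists: "\<exists>u. is_saddle w u"
proof -
  let ?W = "X \<times> Y"
  define T where "T u = closest_point ?W (w - (1 / (4 * L)) *\<^sub>R saddle_field u)" for u
  have "\<exists>!u\<in>?W. T u = u"
  proof (rule Banach_fix)
    show "complete ?W"
      using feasible_closed by (simp add: complete_eq_closed)
    show "T ` ?W \<subseteq> ?W"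
      unfolding T_def using closest_point_in_set[OF feasible_closed feasible_nonempty] by blast
    fix u u' assume u: "u \<in> ?W" "u' \<in> ?W"
    have "dist (T u) (T u') \<le> dist (w - (1 / (4 * L)) *\<^sub>R saddle_field u) (w - (1 / (4 * L)) *\<^sub>R saddle_field u')"
      unfolding T_def by (rule closest_point_lipschitz[OF feasible_convex feasible_closed feasible_nonempty])
    also have "\<dots> = norm ((1 / (4 * L)) *\<^sub>R (saddle_field u' - saddle_field u))"
      by (simp add: dist_norm algebra_simps)
    also have "\<dots> \<le> 1 / (4 * L) * (2 * L * norm (u' - u))"
      using saddle_field_lipschitz[OF u(2,1)] L unfolding norm_scaleR by (intro mult_mono) auto
    also have "\<dots> = 1 / 2 * dist u u'"
      using L by (simp add: dist_norm norm_minus_commute)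
    finally show "dist (T u) (T u') \<le> 1 / 2 * dist u u'" .
  qed (use feasible_nonempty in auto)
  then obtain u where u: "u \<in> ?W" "T u = u"
    by blast
  have "regularized_field w u \<bullet> (u' - u) \<ge> 0" if "u' \<in> ?W" for u'
  proof -
    \<comment> \<open>The obtuse-angle property of the projection at a fixed point of
      \<open>T\<close>; multiplied by -4 L it is the variational inequality.\<close>
    have "(w - (1 / (4 * L)) *\<^sub>R saddle_field u - u) \<bullet> (u' - u) \<le> 0"
      using closest_point_dot[OF feasible_convex feasible_closed that, of "w - (1 / (4 * L)) *\<^sub>R saddle_field u"] u(2)
      by (simp add: T_def)
    moreover have "regularized_field w u = - ((4 * L) *\<^sub>R (w - (1 / (4 * L)) *\<^sub>R saddle_field u - u))"
      using L by (simp add: regularized_field_def algebra_simps)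
    ultimately show ?thesis
      using L by (simp add: mult_le_0_iff)
  qed
  with u show ?thesis
    unfolding is_saddle_def by blast
qed

definition saddle :: "'a \<times> 'b \<Rightarrow> 'a \<times> 'b" where
  "saddle w = (SOME u. is_saddle w u)"

lemma is_saddle_saddle: "is_saddle w (saddle w)"
  unfolding saddle_def by (rule someI_ex[OF saddle_exists])

lemma saddle_in: "saddle w \<in> X \<times> Y" "fst (saddle w) \<in> X" "snd (saddle w) \<in> Y"
  using is_saddle_saddle[of w] unfolding is_saddle_def by auto

lemma saddle_vi: "u' \<in> X \<times> Y \<Longrightarrow> regularized_field w (saddle w) \<bullet> (u' - saddle w) \<ge> 0"
  using is_saddle_saddle[of w] unfolding is_saddle_def by auto

text \<open>Each saddle point is tested in the variational inequality of the other. The fields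
  differ by 4 L (w - w'), so strong monotonicity with modulus 2 L gives the factor 2.\<close>

lemma saddle_lipschitz: "norm (saddle w - saddle w') \<le> 2 * norm (w - w')"
proof -
  let ?u = "saddle w" and ?u' = "saddle w'"
  let ?N = "norm (?u - ?u')"
  have eq: "regularized_field w' ?u = regularized_field w ?u + (4 * L) *\<^sub>R (w - w')"
    by (simp add: regularized_field_def algebra_simps)
  have "2 * L * ?N\<^sup>2 \<le> (regularized_field w' ?u - regularized_field w' ?u') \<bullet> (?u - ?u')"
    by (rule regularized_field_strongly_monotone) (rule saddle_in)+
  also have "\<dots> = - (regularized_field w ?u \<bullet> (?u' - ?u)) - regularized_field w' ?u' \<bullet> (?u - ?u')
      + 4 * L * ((w - w') \<bullet> (?u - ?u'))"
    unfolding eq by (simp add: inner_simps right_diff_distrib)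
  also have "\<dots> \<le> 4 * L * ((w - w') \<bullet> (?u - ?u'))"
    using saddle_vi[OF saddle_in(1), of w w'] saddle_vi[OF saddle_in(1), of w' w] by simp
  also have "\<dots> \<le> 4 * L * (norm (w - w') * ?N)"
    using L norm_cauchy_schwarz by (intro mult_left_mono) auto
  finally have "?N * ?N \<le> (2 * norm (w - w')) * ?N"
    using L by (simp add: power2_eq_square)
  then show ?thesis
    by (cases "?N = 0") (auto simp: mult_le_cancel_right)
qed

lemma saddle_vi_x:
  assumes "x \<in> X"
  shows "(grad_x f (fst (saddle w)) (snd (saddle w)) + (4 * L) *\<^sub>R (fst (saddle w) - fst w)) \<bullet> (x - fst (saddle w)) \<ge> 0"
  using saddle_vi[of "(x, snd (saddle w))" w] assms saddle_in[of w]
  by (cases "saddle w") (simp add: regularized_field_def saddle_field_def inner_prod_def)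

lemma saddle_vi_y:
  assumes "y \<in> Y"
  shows "(grad_y f (fst (saddle w)) (snd (saddle w)) - (4 * L) *\<^sub>R (snd (saddle w) - snd w)) \<bullet> (y - snd (saddle w)) \<le> 0"
  using saddle_vi[of "(fst (saddle w), y)" w] assms saddle_in[of w]
  by (cases "saddle w") (simp add: regularized_field_def saddle_field_def inner_prod_def inner_simps)

definition smoothed_fun :: "'a \<times> 'b \<Rightarrow> 'a \<Rightarrow> 'b \<Rightarrow> real" where
  "smoothed_fun w x y = smoothed f (4 * L) (4 * L) x y (fst w) (snd w)"

definition saddle_value :: "'a \<times> 'b \<Rightarrow> real" where
  "saddle_value w = smoothed_fun w (fst (saddle w)) (snd (saddle w))"

text \<open>The variational inequality removes the first-order term; the proximal square contributes
  2 L |x - a|^2 and dominates the convexity defect L / 2 |x - a|^2.\<close>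

lemma saddle_value_le_x:
  assumes "x \<in> X"
  shows "saddle_value w \<le> smoothed_fun w x (snd (saddle w))"
proof -
  define a y where "a = fst (saddle w)" and "y = snd (saddle w)"
  have "f x y \<ge> f a y + grad_x f a y \<bullet> (x - a) - L / 2 * (norm (x - a))\<^sup>2"
    unfolding a_def y_def using assms saddle_in by (intro lower_bound_x)
  moreover have "(grad_x f a y + (4 * L) *\<^sub>R (a - fst w)) \<bullet> (x - a) \<ge> 0"
    unfolding a_def y_def by (rule saddle_vi_x[OF assms])
  moreover have "(norm (x - fst w))\<^sup>2 = (norm (a - fst w))\<^sup>2 + 2 * ((a - fst w) \<bullet> (x - a)) + (norm (x - a))\<^sup>2"
    unfolding power2_norm_eq_inner by (simp add: inner_simps inner_commute)
  moreover have "0 \<le> L * (norm (x - a))\<^sup>2"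
    using L by simp
  ultimately show ?thesis
    unfolding saddle_value_def smoothed_fun_def smoothed_def a_def[symmetric] y_def[symmetric]
    by (simp add: inner_add_left distrib_left distrib_right)
qed

lemma saddle_value_ge_y:
  assumes "y \<in> Y"
  shows "smoothed_fun w (fst (saddle w)) y \<le> saddle_value w"
proof -
  define x b where "x = fst (saddle w)" and "b = snd (saddle w)"
  have "f x y \<le> f x b + grad_y f x b \<bullet> (y - b) + L / 2 * (norm (y - b))\<^sup>2"
    unfolding x_def b_def using assms saddle_in by (intro upper_bound_y)
  moreover have "(grad_y f x b - (4 * L) *\<^sub>R (b - snd w)) \<bullet> (y - b) \<le> 0"
    unfolding x_def b_def by (rule saddle_vi_y[OF assms])
  moreover have "(norm (y - snd w))\<^sup>2 = (norm (b - snd w))\<^sup>2 + 2 * ((b - snd w) \<bullet> (y - b)) + (norm (y - b))\<^sup>2"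
    unfolding power2_norm_eq_inner by (simp add: inner_simps inner_commute)
  moreover have "0 \<le> L * (norm (y - b))\<^sup>2"
    using L by simp
  ultimately show ?thesis
    unfolding saddle_value_def smoothed_fun_def smoothed_def x_def[symmetric] b_def[symmetric]
    by (simp add: inner_diff_left distrib_left distrib_right right_diff_distrib)
qed

text \<open>A one-sided Danskin estimate. Both saddle values are compared at the mixed point with
  new primal and old dual component, where only the anchor terms differ. Returning to the old primal
  component costs 8 L by \<open>saddle_lipschitz\<close>, the dual square 2 L.\<close>

lemma saddle_value_increment:
  fixes w w' :: "'a \<times> 'b"
  defines "\<Delta> \<equiv> w' - w"
  shows "saddle_value w' - saddle_value w \<ge>
    4 * L * (fst \<Delta> \<bullet> (fst w - fst (saddle w))) + 4 * L * (snd \<Delta> \<bullet> (snd (saddle w) - snd w))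
      - 10 * L * (norm \<Delta>)\<^sup>2"
proof -
  define x x' y where "x = fst (saddle w)" and "x' = fst (saddle w')" and "y = snd (saddle w)"
  have y: "y \<in> Y" and x': "x' \<in> X"
    unfolding y_def x'_def by (rule saddle_in)+
  have "saddle_value w \<le> smoothed_fun w x' y"
    unfolding y_def by (rule saddle_value_le_x[OF x'])
  moreover have "smoothed_fun w' x' y \<le> saddle_value w'"
    unfolding x'_def by (rule saddle_value_ge_y[OF y])
  moreover have "smoothed_fun w' x' y - smoothed_fun w x' y =
      2 * L * ((norm (x' - fst w'))\<^sup>2 - (norm (x' - fst w))\<^sup>2) - 2 * L * ((norm (y - snd w'))\<^sup>2 - (norm (y - snd w))\<^sup>2)"
    by (simp add: smoothed_fun_def smoothed_def algebra_simps)
  moreover have "(norm (x' - fst w'))\<^sup>2 - (norm (x' - fst w))\<^sup>2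
      = 2 * (fst \<Delta> \<bullet> (fst w - x)) - 2 * (fst \<Delta> \<bullet> (x' - x)) + (norm (fst \<Delta>))\<^sup>2"
    unfolding power2_norm_eq_inner \<Delta>_def by (simp add: inner_simps inner_commute)
  moreover have "(norm (y - snd w'))\<^sup>2 - (norm (y - snd w))\<^sup>2
      = - 2 * (snd \<Delta> \<bullet> (y - snd w)) + (norm (snd \<Delta>))\<^sup>2"
    unfolding power2_norm_eq_inner \<Delta>_def by (simp add: inner_simps inner_commute)
  ultimately have *: "saddle_value w' - saddle_value w \<ge>
      4 * L * (fst \<Delta> \<bullet> (fst w - x)) + 4 * L * (snd \<Delta> \<bullet> (y - snd w))
      - 4 * L * (fst \<Delta> \<bullet> (x' - x)) + 2 * L * (norm (fst \<Delta>))\<^sup>2 - 2 * L * (norm (snd \<Delta>))\<^sup>2"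
    by (simp add: distrib_left distrib_right right_diff_distrib)
  have "fst \<Delta> \<bullet> (x' - x) \<le> norm (fst \<Delta>) * norm (x' - x)"
    by (rule norm_cauchy_schwarz)
  also have "\<dots> \<le> norm \<Delta> * (2 * norm \<Delta>)"
  proof (rule mult_mono)
    have "norm (x' - x) \<le> norm (saddle w' - saddle w)"
      unfolding x_def x'_def fst_diff[symmetric] by (metis norm_fst_le prod.collapse)
    also have "\<dots> \<le> 2 * norm \<Delta>"
      unfolding \<Delta>_def by (rule saddle_lipschitz)
    finally show "norm (x' - x) \<le> 2 * norm \<Delta>" .
    show "norm (fst \<Delta>) \<le> norm \<Delta>"
      by (metis norm_fst_le prod.collapse)
  qed auto
  finally have "4 * L * (fst \<Delta> \<bullet> (x' - x)) \<le> 4 * L * (2 * (norm \<Delta>)\<^sup>2)"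
    using L by (intro mult_left_mono) (auto simp: power2_eq_square)
  moreover have "L * (norm (snd \<Delta>))\<^sup>2 \<le> L * (norm \<Delta>)\<^sup>2"
    using L by (intro mult_left_mono power_mono) (metis norm_snd_le prod.collapse, auto)
  moreover have "0 \<le> L * (norm (fst \<Delta>))\<^sup>2"
    using L by simp
  ultimately show ?thesis
    using * unfolding x_def y_def by linarith
qed

section \<open>Contraction of the optimistic step\<close>

lemma G_x_eq: "G_x f (4 * L) (4 * L) s = fst (regularized_field (anchor s) (primal_dual s))"
proof -
  obtain x y z v where s: "s = (x, y, z, v)"
    by (cases s) auto
  have "GDERIV (\<lambda>u. smoothed f (4 * L) (4 * L) u y z v) x :> grad_x f x y + (4 * L) *\<^sub>R (x - z) - 0"
    unfolding smoothed_def
    by (intro GDERIV_diff GDERIV_add GDERIV_const GDERIV_x GDERIV_norm_diff_square)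
  from grad_eqI[OF this] show ?thesis
    by (simp add: s G_x_def regularized_field_def saddle_field_def)
qed

lemma G_y_eq: "G_y f (4 * L) (4 * L) s = snd (regularized_field (anchor s) (primal_dual s))"
proof -
  obtain x y z v where s: "s = (x, y, z, v)"
    by (cases s) auto
  have "GDERIV (\<lambda>w. smoothed f (4 * L) (4 * L) x w z v) y :> grad_y f x y + 0 - (4 * L) *\<^sub>R (y - v)"
    unfolding smoothed_def
    by (intro GDERIV_diff GDERIV_add GDERIV_const GDERIV_y GDERIV_norm_diff_square)
  from grad_eqI[OF this] show ?thesis
    by (simp add: s G_y_def regularized_field_def saddle_field_def)
qed

definition feasible_state :: "'a \<times> 'b \<times> 'a \<times> 'b \<Rightarrow> bool" where
  "feasible_state s \<longleftrightarrow> primal_dual s \<in> X \<times> Y \<and> anchor s \<in> X \<times> Y"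

definition extrapolated_field :: "'a \<times> 'b \<times> 'a \<times> 'b \<Rightarrow> 'a \<times> 'b \<times> 'a \<times> 'b \<Rightarrow> 'a \<times> 'b" where
  "extrapolated_field p c =
     2 *\<^sub>R regularized_field (anchor c) (primal_dual c) - regularized_field (anchor p) (primal_dual p)"

text \<open>The step size 1 / (216 L) gives the extrapolation error in
  \<open>ogda_next_contraction\<close> the weight 27 / 108 = 1 / 4. The rate 1 / 20000 makes squared
  anchor steps small enough to be absorbed in \<open>lyapunov_step\<close>.\<close>

definition ogda_next :: "real \<Rightarrow> 'a \<times> 'b \<times> 'a \<times> 'b \<Rightarrow> 'a \<times> 'b \<times> 'a \<times> 'b \<Rightarrow> 'a \<times> 'b \<times> 'a \<times> 'b" where
  "ogda_next \<beta> p c =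
     ds_ogda_step X Y f (4 * L) (4 * L) (1 / (216 * L)) (1 / (216 * L)) \<beta> (1 / 20000) p c"

lemma anchor_ogda_next:
  "anchor (ogda_next \<beta> p c) - anchor c =
     (\<beta> *\<^sub>R (fst (primal_dual c) - fst (anchor c)), (1 / 20000) *\<^sub>R (snd (primal_dual c) - snd (anchor c)))"
  by (cases c) (simp add: ogda_next_def ds_ogda_step_def)

lemma primal_dual_ogda_next:
  "primal_dual (ogda_next \<beta> p c) =
    (closest_point X (fst (primal_dual c - (1 / (216 * L)) *\<^sub>R extrapolated_field p c)),
     closest_point Y (snd (primal_dual c - (1 / (216 * L)) *\<^sub>R extrapolated_field p c)))"
  by (cases c)
    (simp add: ogda_next_def ds_ogda_step_def G_x_eq G_y_eq extrapolated_field_def,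
      simp add: scaleR_2 algebra_simps)

lemma feasible_ogda_next:
  assumes "feasible_state c" "0 \<le> \<beta>" "\<beta> \<le> 1"
  shows "feasible_state (ogda_next \<beta> p c)"
proof -
  obtain x y z v where c: "c = (x, y, z, v)"
    by (cases c) auto
  have "z + \<beta> *\<^sub>R (x - z) \<in> X"
    using assms X by (intro convex_step_in) (auto simp: feasible_state_def c)
  moreover have "v + (1 / 20000) *\<^sub>R (y - v) \<in> Y"
    using assms Y by (intro convex_step_in) (auto simp: feasible_state_def c)
  moreover have "anchor (ogda_next \<beta> p c) = (z + \<beta> *\<^sub>R (x - z), v + (1 / 20000) *\<^sub>R (y - v))"
    by (simp add: c ogda_next_def ds_ogda_step_def)
  ultimately show ?thesis
    unfolding feasible_state_def primal_dual_ogda_next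
    using X Y by (auto intro!: closest_point_in_set compact_imp_closed)
qed

text \<open>The separate projections onto X and Y form the projection onto the product, so their
  obtuse-angle inequalities add up.\<close>

lemma ogda_next_projection:
  assumes "q \<in> X \<times> Y"
  shows "(primal_dual c - (1 / (216 * L)) *\<^sub>R extrapolated_field p c - primal_dual (ogda_next \<beta> p c))
    \<bullet> (q - primal_dual (ogda_next \<beta> p c)) \<le> 0"
proof -
  let ?m = "primal_dual c - (1 / (216 * L)) *\<^sub>R extrapolated_field p c"
  obtain a b where m: "?m = (a, b)"
    by fastforce
  obtain x y where q: "q = (x, y)"
    by fastforce
  have "(a - closest_point X a) \<bullet> (x - closest_point X a) \<le> 0"
    using assms X by (intro closest_point_dot) (auto simp: q)
  moreover have "(b - closest_point Y b) \<bullet> (y - closest_point Y b) \<le> 0"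
    using assms Y by (intro closest_point_dot) (auto simp: q compact_imp_closed)
  ultimately show ?thesis
    unfolding primal_dual_ogda_next m q by simp
qed

text \<open>The extrapolated direction stands in for the field at the new point, as in an implicit
  step; the error is the difference of two successive field increments, (G - P) - (H - G).\<close>

lemma extrapolation_error:
  fixes p c :: "'a \<times> 'b \<times> 'a \<times> 'b"
  assumes "feasible_state p" "feasible_state c" "h \<in> X \<times> Y"
  shows "norm (extrapolated_field p c - regularized_field (anchor c) h) \<le>
    6 * L * norm (h - primal_dual c) + 6 * L * norm (primal_dual c - primal_dual p)
      + 4 * L * norm (anchor c - anchor p)"
proof -
  let ?G = "regularized_field (anchor c) (primal_dual c)"
  let ?H = "regularized_field (anchor c) h"
  let ?P = "regularized_field (anchor p) (primal_dual p)"
  have "extrapolated_field p c - ?H = (?G - ?P) - (?H - ?G)"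
    by (simp add: extrapolated_field_def scaleR_2)
  also have "norm \<dots> \<le> norm (?G - ?P) + norm (?H - ?G)"
    by (rule norm_triangle_ineq4)
  also have "norm (?G - ?P) \<le> 6 * L * norm (primal_dual c - primal_dual p) + 4 * L * norm (anchor c - anchor p)"
    using assms by (intro regularized_field_lipschitz) (auto simp: feasible_state_def)
  also have "norm (?H - ?G) \<le> 6 * L * norm (h - primal_dual c) + 4 * L * norm (anchor c - anchor c)"
    using assms by (intro regularized_field_lipschitz) (auto simp: feasible_state_def)
  finally show ?thesis
    by simp
qed

lemma ogda_next_contraction:
  fixes p c :: "'a \<times> 'b \<times> 'a \<times> 'b"
  assumes p: "feasible_state p" and c: "feasible_state c" and \<beta>: "0 \<le> \<beta>" "\<beta> \<le> 1"
  defines "h \<equiv> primal_dual (ogda_next \<beta> p c)"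
  shows "109 / 108 * (norm (h - saddle (anchor c)))\<^sup>2 + 3 / 4 * (norm (h - primal_dual c))\<^sup>2 \<le>
    (norm (primal_dual c - saddle (anchor c)))\<^sup>2 + 1 / 4 * (norm (primal_dual c - primal_dual p))\<^sup>2
      + 1 / 4 * (norm (anchor c - anchor p))\<^sup>2"
proof -
  define u us where "u = primal_dual c" and "us = saddle (anchor c)"
  define E d' d \<omega> where "E = norm (h - us)" and "d' = norm (h - u)"
    and "d = norm (u - primal_dual p)" and "\<omega> = norm (anchor c - anchor p)"
  let ?H = "regularized_field (anchor c) h"
  have h: "h \<in> X \<times> Y"
    using feasible_ogda_next[OF c \<beta>] unfolding h_def feasible_state_def by blast
  have us: "us \<in> X \<times> Y"
    unfolding us_def by (rule saddle_in)
  have "(u - (1 / (216 * L)) *\<^sub>R extrapolated_field p c - h) \<bullet> (us - h) \<le> 0"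
    unfolding h_def u_def by (rule ogda_next_projection[OF us])
  then have "(u - h) \<bullet> (us - h) \<le> 1 / (216 * L) * (extrapolated_field p c \<bullet> (us - h))"
    by (simp add: inner_diff_left)
  also have "extrapolated_field p c \<bullet> (us - h) \<le> (6 * L * d' + 6 * L * d + 4 * L * \<omega>) * E - 2 * L * E\<^sup>2"
  proof -
    have "(?H - regularized_field (anchor c) us) \<bullet> (h - us) \<ge> 2 * L * E\<^sup>2"
      unfolding E_def by (rule regularized_field_strongly_monotone[OF h us])
    moreover have "regularized_field (anchor c) us \<bullet> (h - us) \<ge> 0"
      unfolding us_def by (rule saddle_vi[OF h])
    moreover have "(extrapolated_field p c - ?H) \<bullet> (us - h) \<le> (6 * L * d' + 6 * L * d + 4 * L * \<omega>) * E"
    proof -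
      have "(extrapolated_field p c - ?H) \<bullet> (us - h) \<le> norm (extrapolated_field p c - ?H) * norm (us - h)"
        by (rule norm_cauchy_schwarz)
      also have "\<dots> \<le> (6 * L * d' + 6 * L * d + 4 * L * \<omega>) * E"
        unfolding E_def norm_minus_commute[of us h] d'_def d_def \<omega>_def u_def
        by (intro mult_right_mono extrapolation_error p c h norm_ge_zero)
      finally show ?thesis .
    qed
    ultimately show ?thesis
      by (simp add: inner_simps)
  qed
  finally have "(u - h) \<bullet> (us - h) \<le> 1 / (216 * L) * ((6 * L * d' + 6 * L * d + 4 * L * \<omega>) * E - 2 * L * E\<^sup>2)"
    using L by (simp add: divide_right_mono)
  also have "\<dots> = 1 / 108 * ((3 * d' + 3 * d + 2 * \<omega>) * E - E\<^sup>2)"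
    using L by (simp add: field_simps power2_eq_square)
  finally have "2 * ((u - h) \<bullet> (us - h)) \<le> 1 / 54 * ((3 * d' + 3 * d + 2 * \<omega>) * E - E\<^sup>2)"
    by simp
  moreover have "(norm (u - us))\<^sup>2 = d'\<^sup>2 + E\<^sup>2 - 2 * ((u - h) \<bullet> (us - h))"
    unfolding d'_def E_def power2_norm_eq_inner by (simp add: inner_simps inner_commute)
  \<comment> \<open>Young's inequality spends half of the gain E^2 / 54, leaving E^2 / 108. With the
    next bound, d'^2 and d^2 receive weight 27 / 108 and \<omega>^2 receives 12 / 108.\<close>
  moreover have "2 * ((3 * d' + 3 * d + 2 * \<omega>) * E) \<le> (3 * d' + 3 * d + 2 * \<omega>)\<^sup>2 + E\<^sup>2"
    using zero_le_power2[of "(3 * d' + 3 * d + 2 * \<omega>) - E"] unfolding power2_diff by linarith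
  moreover have "(3 * d' + 3 * d + 2 * \<omega>)\<^sup>2 \<le> 3 * (9 * d'\<^sup>2 + 9 * d\<^sup>2 + 4 * \<omega>\<^sup>2)"
    using zero_le_power2[of "3 * d' - 3 * d"] zero_le_power2[of "3 * d - 2 * \<omega>"]
      zero_le_power2[of "2 * \<omega> - 3 * d'"]
    by (simp add: power2_eq_square algebra_simps)
  moreover have "0 \<le> \<omega>\<^sup>2"
    by simp
  ultimately have "109 / 108 * E\<^sup>2 + 3 / 4 * d'\<^sup>2 \<le> (norm (u - us))\<^sup>2 + 1 / 4 * d\<^sup>2 + 1 / 4 * \<omega>\<^sup>2"
    by argo
  then show ?thesis
    unfolding E_def d'_def d_def \<omega>_def u_def us_def .
qed

text \<open>The last two summands carry the extrapolation error into the next step.\<close>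

definition tracking_energy :: "'a \<times> 'b \<times> 'a \<times> 'b \<Rightarrow> 'a \<times> 'b \<times> 'a \<times> 'b \<Rightarrow> real" where
  "tracking_energy p c = (norm (primal_dual c - saddle (anchor c)))\<^sup>2
     + 1 / 2 * (norm (primal_dual c - primal_dual p))\<^sup>2 + 1 / 2 * (norm (anchor c - anchor p))\<^sup>2"

lemma tracking_energy_step:
  fixes p c :: "'a \<times> 'b \<times> 'a \<times> 'b"
  assumes "feasible_state p" "feasible_state c" "0 \<le> \<beta>" "\<beta> \<le> 1"
  defines "n \<equiv> ogda_next \<beta> p c"
  shows "tracking_energy c n \<le> 217 / 218 * tracking_energy p c + 869 * (norm (anchor n - anchor c))\<^sup>2"
proof -
  define E e' k d' d \<omega>' \<omega> e where "E = norm (primal_dual n - saddle (anchor c))"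
    and "e' = norm (primal_dual n - saddle (anchor n))"
    and "k = norm (saddle (anchor n) - saddle (anchor c))"
    and "d' = norm (primal_dual n - primal_dual c)" and "d = norm (primal_dual c - primal_dual p)"
    and "\<omega>' = norm (anchor n - anchor c)" and "\<omega> = norm (anchor c - anchor p)"
    and "e = norm (primal_dual c - saddle (anchor c))"
  have "e' \<le> E + k"
    unfolding e'_def E_def k_def
    using norm_triangle_ineq4[of "primal_dual n - saddle (anchor c)" "saddle (anchor n) - saddle (anchor c)"]
    by simp
  moreover have "k \<le> 2 * \<omega>'"
    unfolding k_def \<omega>'_def by (rule saddle_lipschitz)
  ultimately have "e' \<le> E + 2 * \<omega>'"
    by simp
  then have "e'\<^sup>2 \<le> (E + 2 * \<omega>')\<^sup>2"
    unfolding e'_def by (intro power_mono) auto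
  \<comment> \<open>The drift of the saddle point is split off by Young's inequality with weight 1 /
    216, half of the contraction surplus 1 / 108: as 217 / 216 = 217 / 218 * 109 / 108, the rate 217
    / 218 remains.\<close>
  also have "\<dots> \<le> 217 / 216 * E\<^sup>2 + 868 * \<omega>'\<^sup>2"
    using zero_le_power2[of "1 / 216 * E - 2 * \<omega>'"] by (simp add: power2_eq_square algebra_simps)
  finally have 1: "e'\<^sup>2 \<le> 217 / 216 * E\<^sup>2 + 868 * \<omega>'\<^sup>2" .
  have 2: "109 / 108 * E\<^sup>2 + 3 / 4 * d'\<^sup>2 \<le> e\<^sup>2 + 1 / 4 * d\<^sup>2 + 1 / 4 * \<omega>\<^sup>2"
    unfolding E_def d'_def d_def e_def \<omega>_def n_def by (rule ogda_next_contraction[OF assms(1-4)])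
  have "0 \<le> d'\<^sup>2" "0 \<le> d\<^sup>2" "0 \<le> \<omega>\<^sup>2" "0 \<le> \<omega>'\<^sup>2"
    by auto
  then have "e'\<^sup>2 + 1 / 2 * d'\<^sup>2 + 1 / 2 * \<omega>'\<^sup>2 \<le> 217 / 218 * (e\<^sup>2 + 1 / 2 * d\<^sup>2 + 1 / 2 * \<omega>\<^sup>2) + 869 * \<omega>'\<^sup>2"
    using 1 2 by argo
  then show ?thesis
    unfolding tracking_energy_def e'_def d'_def \<omega>'_def e_def d_def \<omega>_def .
qed

end

section \<open>Descent of the potential\<close>

text \<open>The lower bound makes the Moreau envelope well defined; it is assumed in the concave
  case and follows from compactness of X in the KL case.\<close>

locale bounded_minimax_problem = minimax_problem +
  assumes bdd: "bdd_below (max_val Y f ` X)"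
begin

abbreviation prox_point :: "real \<Rightarrow> 'a \<Rightarrow> 'a" where
  "prox_point \<equiv> prox (primal_fun X Y f)"

text \<open>Adding the growth inequalities at the two proximal points cancels \<open>max_val\<close>
  and leaves 3 L |p' - p|^2 against 4 L times the inner product of z' - z and p' - p.\<close>

lemma prox_point_lipschitz:
  "norm (prox_point (4 * L) z' - prox_point (4 * L) z) \<le> 4 / 3 * norm (z' - z)"
proof -
  let ?p = "prox_point (4 * L) z" and ?p' = "prox_point (4 * L) z'"
  let ?h = "prox_objective Y f (4 * L)"
  let ?N = "norm (?p' - ?p)"
  have r: "4 * L > L"
    using L by simp
  have "?h z ?p' \<ge> ?h z ?p + (4 * L - L) / 2 * ?N\<^sup>2"
    by (intro prox_objective_growth[OF bdd r] prox_in[OF bdd r])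
  moreover have "?h z' ?p \<ge> ?h z' ?p' + (4 * L - L) / 2 * (norm (?p - ?p'))\<^sup>2"
    by (intro prox_objective_growth[OF bdd r] prox_in[OF bdd r])
  moreover have "?h z ?p' - ?h z' ?p' - (?h z ?p - ?h z' ?p) = 4 * L * ((z' - z) \<bullet> (?p' - ?p))"
    unfolding prox_objective_def power2_norm_eq_inner
    by (simp add: inner_simps inner_commute algebra_simps)
  ultimately have "3 * L * ?N\<^sup>2 \<le> 4 * L * ((z' - z) \<bullet> (?p' - ?p))"
    by (simp add: norm_minus_commute[of ?p ?p'])
  also have "\<dots> \<le> 4 * L * (norm (z' - z) * ?N)"
    using L norm_cauchy_schwarz by (intro mult_left_mono) auto
  finally have "?N * ?N \<le> (4 / 3 * norm (z' - z)) * ?N"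
    using L by (simp add: power2_eq_square)
  then show ?thesis
    by (cases "?N = 0") (auto simp: mult_le_cancel_right)
qed

text \<open>The algorithm uses weight 4 L, but stationarity is claimed for every r > L. Adding the
  growth inequalities of both objectives cancels \<open>max_val\<close>; if the residual A for r
  exceeds the residual B for 4 L, the reverse triangle inequality makes the bound linear in A and
  B.\<close>

lemma prox_residual_change_parameter:
  assumes r: "r > L"
  shows "norm (prox_point r z - z) \<le> (1 + 3 * L / (r - L)) * norm (prox_point (4 * L) z - z)"
proof -
  let ?p = "prox_point r z" and ?p' = "prox_point (4 * L) z"
  define A B where "A = norm (?p - z)" and "B = norm (?p' - z)"
  have r': "4 * L > L"
    using L by simp
  have "prox_objective Y f r z ?p' \<ge> prox_objective Y f r z ?p + (r - L) / 2 * (norm (?p' - ?p))\<^sup>2"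
    by (intro prox_objective_growth[OF bdd r] prox_in[OF bdd r'])
  moreover have "prox_objective Y f (4 * L) z ?p \<ge> prox_objective Y f (4 * L) z ?p' + (4 * L - L) / 2 * (norm (?p - ?p'))\<^sup>2"
    by (intro prox_objective_growth[OF bdd r'] prox_in[OF bdd r])
  ultimately have *: "(r + 2 * L) * (norm (?p - ?p'))\<^sup>2 \<le> (4 * L - r) * (A\<^sup>2 - B\<^sup>2)"
    unfolding prox_objective_def A_def B_def norm_minus_commute[of ?p' ?p] by (simp add: field_simps)
  have "A \<le> B + 3 * L / (r - L) * B"
  proof (cases "A \<le> B")
    case True
    have "0 \<le> 3 * L / (r - L) * B"
      using r L by (simp add: B_def)
    with True show ?thesis
      by simp
  next
    case False
    have "A - B \<le> norm (?p - ?p')"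
      unfolding A_def B_def using norm_triangle_ineq2[of "?p - z" "?p' - z"] by simp
    then have "(A - B)\<^sup>2 \<le> (norm (?p - ?p'))\<^sup>2"
      using False by (intro power_mono) auto
    then have "(r + 2 * L) * (A - B)\<^sup>2 \<le> (4 * L - r) * (A\<^sup>2 - B\<^sup>2)"
      using r L by (intro order_trans[OF mult_left_mono *]) auto
    then have "(A - B) * ((r + 2 * L) * (A - B)) \<le> (A - B) * ((4 * L - r) * (A + B))"
      by (simp add: power2_eq_square algebra_simps)
    then have "(r + 2 * L) * (A - B) \<le> (4 * L - r) * (A + B)"
      using False by (simp add: mult_le_cancel_left)
    then have "(r - L) * A \<le> 3 * L * B"
      by (simp add: algebra_simps)
    then have "A \<le> 3 * L / (r - L) * B"
      using r by (simp add: field_simps)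
    moreover have "0 \<le> B"
      by (simp add: B_def)
    ultimately show ?thesis
      by linarith
  qed
  then show ?thesis
    by (simp add: A_def B_def distrib_right)
qed

definition envelope :: "'a \<Rightarrow> real" where
  "envelope z = prox_objective Y f (4 * L) z (prox_point (4 * L) z)"

lemma envelope_le: "x \<in> X \<Longrightarrow> envelope z \<le> prox_objective Y f (4 * L) z x"
proof -
  assume "x \<in> X"
  from prox_objective_growth[OF bdd _ this, of "4 * L" z] show ?thesis
    unfolding envelope_def using L by (smt (verit) divide_nonneg_nonneg mult_nonneg_nonneg zero_le_power2)
qed

lemma prox_point_in: "prox_point (4 * L) z \<in> X"
  using prox_in[OF bdd, of "4 * L" z] L by simp

text \<open>The old proximal point is a candidate for the new anchor, and the difference of
  objectives is an explicit quadratic.\<close>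

lemma envelope_increment:
  "envelope z' - envelope z \<le> 4 * L * ((z' - z) \<bullet> (z - prox_point (4 * L) z)) + 2 * L * (norm (z' - z))\<^sup>2"
proof -
  let ?p = "prox_point (4 * L) z"
  have "envelope z' \<le> prox_objective Y f (4 * L) z' ?p"
    by (rule envelope_le[OF prox_point_in])
  moreover have "prox_objective Y f (4 * L) z' ?p - prox_objective Y f (4 * L) z ?p
      = 4 * L * ((z' - z) \<bullet> (z - ?p)) + 2 * L * (norm (z' - z))\<^sup>2"
    unfolding prox_objective_def power2_norm_eq_inner
    by (simp add: inner_simps inner_commute algebra_simps)
  ultimately show ?thesis
    by (simp add: envelope_def)
qed

text \<open>The proximal point competes with the saddle point in x, with y kept at the saddle; the
  dual proximal terms then cancel.\<close>

lemma saddle_payoff_le_envelope: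
  "f (fst (saddle w)) (snd (saddle w)) + 2 * L * (norm (fst (saddle w) - fst w))\<^sup>2 \<le> envelope (fst w)"
proof -
  let ?p = "prox_point (4 * L) (fst w)"
  have "saddle_value w \<le> smoothed_fun w ?p (snd (saddle w))"
    by (rule saddle_value_le_x[OF prox_point_in])
  moreover have "f ?p (snd (saddle w)) \<le> max_val Y f ?p"
    by (rule max_val_ge) (rule saddle_in)
  ultimately show ?thesis
    by (simp add: saddle_value_def smoothed_fun_def smoothed_def envelope_def prox_objective_def)
qed

definition saddle_gap :: "'a \<times> 'b \<Rightarrow> real" where
  "saddle_gap w = max_val Y f (fst (saddle w)) - f (fst (saddle w)) (snd (saddle w))"

lemma saddle_gap_nonneg: "0 \<le> saddle_gap w"
  unfolding saddle_gap_def using max_val_ge[OF saddle_in(3)] by simp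

text \<open>Quadratic growth bounds the squared distance by the excess of the objective over the
  envelope, and \<open>saddle_payoff_le_envelope\<close> bounds this excess by the dual gap.\<close>

lemma prox_error_le_gap:
  "3 / 2 * L * (norm (fst (saddle w) - prox_point (4 * L) (fst w)))\<^sup>2 \<le> saddle_gap w"
proof -
  have "prox_objective Y f (4 * L) (fst w) (fst (saddle w)) \<ge> envelope (fst w)
      + (4 * L - L) / 2 * (norm (fst (saddle w) - prox_point (4 * L) (fst w)))\<^sup>2"
    unfolding envelope_def using L by (intro prox_objective_growth[OF bdd] saddle_in) auto
  with saddle_payoff_le_envelope[of w] show ?thesis
    by (simp add: saddle_gap_def prox_objective_def)
qed

text \<open>The anchor component v ascends and z descends on the saddle value, so its negative alone
  has the wrong sign in z; the doubled envelope reverses that sign up to the prox error. Division by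
  4 L frees the step terms of L.\<close>

definition potential :: "'a \<times> 'b \<Rightarrow> real" where
  "potential w = (2 * envelope (fst w) - saddle_value w) / (4 * L)"

text \<open>The saddle value p is at most the envelope P, so 2 P - p is at least P, which lies above
  the infimum of \<open>max_val\<close>.\<close>

lemma potential_lower_bound:
  "Inf (max_val Y f ` X) / (4 * L) \<le> potential w"
proof -
  have "saddle_value w \<le> f (fst (saddle w)) (snd (saddle w)) + 2 * L * (norm (fst (saddle w) - fst w))\<^sup>2"
    using L by (simp add: saddle_value_def smoothed_fun_def smoothed_def)
  then have "saddle_value w \<le> envelope (fst w)"
    using saddle_payoff_le_envelope[of w] by simp
  moreover have "Inf (max_val Y f ` X) \<le> max_val Y f (prox_point (4 * L) (fst w))"
    using bdd prox_point_in by (intro cInf_lower) auto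
  then have "Inf (max_val Y f ` X) \<le> envelope (fst w)"
    using L by (simp add: envelope_def prox_objective_def)
      (smt (verit) mult_nonneg_nonneg zero_le_power2)
  ultimately show ?thesis
    unfolding potential_def using L by (intro divide_right_mono) auto
qed

lemma potential_increment:
  fixes w w' :: "'a \<times> 'b"
  defines "\<Delta> \<equiv> w' - w"
  shows "potential w' - potential w \<le> fst \<Delta> \<bullet> (fst w - fst (saddle w))
    + 2 * (fst \<Delta> \<bullet> (fst (saddle w) - prox_point (4 * L) (fst w)))
    - snd \<Delta> \<bullet> (snd (saddle w) - snd w) + 7 / 2 * (norm \<Delta>)\<^sup>2"
proof -
  let ?p = "prox_point (4 * L) (fst w)" and ?x = "fst (saddle w)"
  have 1: "envelope (fst w') - envelope (fst w) \<le> 4 * L * (fst \<Delta> \<bullet> (fst w - ?p)) + 2 * L * (norm (fst \<Delta>))\<^sup>2"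
    using envelope_increment[of "fst w'" "fst w"] by (simp add: \<Delta>_def)
  have 2: "saddle_value w' - saddle_value w \<ge> 4 * L * (fst \<Delta> \<bullet> (fst w - ?x))
      + 4 * L * (snd \<Delta> \<bullet> (snd (saddle w) - snd w)) - 10 * L * (norm \<Delta>)\<^sup>2"
    unfolding \<Delta>_def by (rule saddle_value_increment)
  have "norm (fst \<Delta>) \<le> norm \<Delta>"
    by (metis norm_fst_le prod.collapse)
  then have 3: "2 * L * (norm (fst \<Delta>))\<^sup>2 \<le> 2 * L * (norm \<Delta>)\<^sup>2"
    using L by (intro mult_left_mono power_mono) auto
  have "potential w' - potential w
      = (2 * (envelope (fst w') - envelope (fst w)) - (saddle_value w' - saddle_value w)) / (4 * L)"
    unfolding potential_def diff_divide_distrib[symmetric] by simp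
  also have "\<dots> \<le> (4 * L * (2 * (fst \<Delta> \<bullet> (fst w - ?p)) - fst \<Delta> \<bullet> (fst w - ?x)
      - snd \<Delta> \<bullet> (snd (saddle w) - snd w) + 7 / 2 * (norm \<Delta>)\<^sup>2)) / (4 * L)"
  proof (rule divide_right_mono)
    \<comment> \<open>The square terms 2 * 2 L from the envelope and 10 L from the saddle value add
      up to 14 L = 4 L * 7 / 2.\<close>
    have eq: "4 * L * (2 * (fst \<Delta> \<bullet> (fst w - ?p)) - fst \<Delta> \<bullet> (fst w - ?x)
        - snd \<Delta> \<bullet> (snd (saddle w) - snd w) + 7 / 2 * (norm \<Delta>)\<^sup>2)
      = 2 * (4 * L * (fst \<Delta> \<bullet> (fst w - ?p))) - 4 * L * (fst \<Delta> \<bullet> (fst w - ?x))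
        - 4 * L * (snd \<Delta> \<bullet> (snd (saddle w) - snd w)) + 14 * L * (norm \<Delta>)\<^sup>2"
      by (simp add: algebra_simps)
    show "2 * (envelope (fst w') - envelope (fst w)) - (saddle_value w' - saddle_value w)
        \<le> 4 * L * (2 * (fst \<Delta> \<bullet> (fst w - ?p)) - fst \<Delta> \<bullet> (fst w - ?x)
        - snd \<Delta> \<bullet> (snd (saddle w) - snd w) + 7 / 2 * (norm \<Delta>)\<^sup>2)"
      unfolding eq using 1 2 3 by argo
  qed (use L in simp)
  also have "\<dots> = 2 * (fst \<Delta> \<bullet> (fst w - ?p)) - fst \<Delta> \<bullet> (fst w - ?x)
      - snd \<Delta> \<bullet> (snd (saddle w) - snd w) + 7 / 2 * (norm \<Delta>)\<^sup>2"
    using L by simp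
  finally show ?thesis
    by (simp add: inner_diff_right)
qed

definition primal_shift :: "'a \<times> 'b \<Rightarrow> real" where
  "primal_shift w = norm (fst (saddle w) - fst w)"

definition dual_shift :: "'a \<times> 'b \<Rightarrow> real" where
  "dual_shift w = norm (snd (saddle w) - snd w)"

definition prox_error :: "'a \<times> 'b \<Rightarrow> real" where
  "prox_error w = norm (fst (saddle w) - prox_point (4 * L) (fst w))"

definition lyapunov :: "'a \<times> 'b \<times> 'a \<times> 'b \<Rightarrow> 'a \<times> 'b \<times> 'a \<times> 'b \<Rightarrow> real" where
  "lyapunov p c = potential (anchor c) + tracking_energy p c"

text \<open>Only the prox error is not absorbed: the anchor steps gain in both shifts, and
  deviations of the iterates from the saddle point are paid by the contraction of
  \<open>tracking_energy\<close>, half of whose loss 1 / 218 is kept.\<close>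

lemma lyapunov_step:
  fixes p c :: "'a \<times> 'b \<times> 'a \<times> 'b"
  assumes p: "feasible_state p" and c: "feasible_state c" and \<beta>: "0 \<le> \<beta>" "\<beta> \<le> 1 / 20000"
  defines "n \<equiv> ogda_next \<beta> p c"
  shows "lyapunov c n \<le> lyapunov p c - \<beta> / 8 * (primal_shift (anchor c))\<^sup>2
    - 3 / 160000 * (dual_shift (anchor c))\<^sup>2 - 1 / 436 * tracking_energy p c + 8 * \<beta> * (prox_error (anchor c))\<^sup>2"
proof -
  define x y z v where "x = fst (primal_dual c)" and "y = snd (primal_dual c)"
    and "z = fst (anchor c)" and "v = snd (anchor c)"
  define x' y' q where "x' = fst (saddle (anchor c))" and "y' = snd (saddle (anchor c))"
    and "q = prox_point (4 * L) z"
  define A S F G where "A = (norm (x' - z))\<^sup>2" and "S = (norm (y' - v))\<^sup>2"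
    and "F = (norm (x - x'))\<^sup>2" and "G = (norm (y - y'))\<^sup>2"
  define g where "g = (norm (x' - q))\<^sup>2"
  let ?D = "anchor n - anchor c"
  have D: "fst ?D = \<beta> *\<^sub>R (x - z)" "snd ?D = (1 / 20000) *\<^sub>R (y - v)"
    using anchor_ogda_next[of \<beta> p c] unfolding n_def x_def y_def z_def v_def by auto
  have shifts: "(primal_shift (anchor c))\<^sup>2 = A" "(dual_shift (anchor c))\<^sup>2 = S" "(prox_error (anchor c))\<^sup>2 = g"
    by (simp_all add: primal_shift_def dual_shift_def prox_error_def A_def S_def g_def x'_def y'_def z_def v_def q_def)
  have pos: "0 \<le> A" "0 \<le> S" "0 \<le> F" "0 \<le> G" "0 \<le> g"
    by (auto simp: A_def S_def F_def G_def g_def)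
  have FG: "F + G \<le> tracking_energy p c"
  proof -
    have "(norm (primal_dual c - saddle (anchor c)))\<^sup>2 = F + G"
      by (cases "saddle (anchor c)") (simp add: F_def G_def x_def y_def x'_def y'_def norm_Pair)
    then show ?thesis
      by (simp add: tracking_energy_def)
  qed
  have xz: "(norm (x - z))\<^sup>2 \<le> 2 * F + 2 * A" and yv: "(norm (y - v))\<^sup>2 \<le> 2 * G + 2 * S"
    unfolding A_def F_def S_def G_def by (rule norm_diff_square_le)+
  have t1: "fst ?D \<bullet> (z - x') \<le> \<beta> * (- A / 2 + F / 2)"
    unfolding D A_def F_def by (rule tracked_step_inner[OF \<beta>(1)])
  have t2: "- (snd ?D \<bullet> (y' - v)) \<le> 1 / 20000 * (- S / 2 + G / 2)"
    using tracked_step_inner[of "1 / 20000" y v y'] unfolding D S_def G_def by (simp add: inner_diff_right)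
  \<comment> \<open>The weight 1 / 8 is chosen so that, after |x - z|^2 \<le> 2 F + 2 A, only A / 4
    of the gain A / 2 is spent.\<close>
  have "2 * ((x - z) \<bullet> (x' - q)) \<le> 1 / 8 * (norm (x - z))\<^sup>2 + 8 * g"
  proof -
    have "0 \<le> (norm ((1 / 2) *\<^sub>R (x - z) - 4 *\<^sub>R (x' - q)))\<^sup>2"
      by simp
    moreover have "(norm ((1 / 2) *\<^sub>R (x - z) - 4 *\<^sub>R (x' - q)))\<^sup>2
        = 1 / 4 * (norm (x - z))\<^sup>2 + 16 * g - 4 * ((x - z) \<bullet> (x' - q))"
      unfolding g_def power2_norm_eq_inner by (simp add: inner_simps inner_commute field_simps)
    ultimately show ?thesis
      by argo
  qed
  then have "2 * ((x - z) \<bullet> (x' - q)) \<le> A / 4 + F / 4 + 8 * g"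
    using xz by argo
  then have t3: "2 * (fst ?D \<bullet> (x' - q)) \<le> \<beta> * (A / 4 + F / 4 + 8 * g)"
    unfolding D using \<beta>(1) mult_left_mono by fastforce
  have "potential (anchor n) - potential (anchor c) \<le> fst ?D \<bullet> (z - x') + 2 * (fst ?D \<bullet> (x' - q))
      - snd ?D \<bullet> (y' - v) + 7 / 2 * (norm ?D)\<^sup>2"
    unfolding z_def x'_def y'_def q_def v_def by (rule potential_increment)
  moreover have "tracking_energy c n \<le> 217 / 218 * tracking_energy p c + 869 * (norm ?D)\<^sup>2"
    unfolding n_def using \<beta> by (intro tracking_energy_step p c) auto
  \<comment> \<open>The total weight of this square is 869 + 7 / 2. Trading one of two factors
    \<beta> for 1 / 20000 keeps its shares of \<beta> A and of S / 20000 below 1 / 8 each.\<close>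
  moreover have "(norm ?D)\<^sup>2 \<le> 1 / 10000 * (\<beta> * A + 1 / 20000 * S) + 1 / 200000000 * (F + G)"
  proof -
    have "(norm ?D)\<^sup>2 = (norm (fst ?D))\<^sup>2 + (norm (snd ?D))\<^sup>2"
      by (metis norm_Pair prod.collapse real_sqrt_pow2 sum_power2_ge_zero)
    also have "\<dots> = \<beta>\<^sup>2 * (norm (x - z))\<^sup>2 + (1 / 20000)\<^sup>2 * (norm (y - v))\<^sup>2"
      unfolding D by (simp add: power_mult_distrib power_divide)
    also have "\<dots> \<le> \<beta>\<^sup>2 * (2 * F + 2 * A) + (1 / 20000)\<^sup>2 * (2 * G + 2 * S)"
      by (intro add_mono mult_left_mono xz yv) auto
    also have "\<dots> = 2 * (\<beta>\<^sup>2 * F) + 2 * (\<beta>\<^sup>2 * A) + (1 / 20000)\<^sup>2 * (2 * G + 2 * S)"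
      by (simp add: algebra_simps)
    also have "\<beta>\<^sup>2 * F \<le> (1 / 20000)\<^sup>2 * F"
      using \<beta> pos by (intro mult_right_mono power_mono) auto
    also have "\<beta>\<^sup>2 * A \<le> 1 / 20000 * (\<beta> * A)"
      unfolding power2_eq_square mult.assoc[of \<beta> \<beta> A] using \<beta> pos by (intro mult_right_mono) auto
    finally show ?thesis
      by (simp add: power2_eq_square field_simps)
  qed
  moreover have "\<beta> * F \<le> 1 / 20000 * F"
    using \<beta> pos by (intro mult_right_mono) auto
  moreover have "0 \<le> \<beta> * A"
    using \<beta> pos by simp
  ultimately show ?thesis
    unfolding lyapunov_def shifts
    using t1 t2 t3 FG pos unfolding distrib_left mult_minus_right by argo
qed

section \<open>Convergence rates\<close>

definition ogda_pair :: "real \<Rightarrow> 'a \<Rightarrow> 'b \<Rightarrow> nat \<Rightarrow> ('a \<times> 'b \<times> 'a \<times> 'b) \<times> ('a \<times> 'b \<times> 'a \<times> 'b)" where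
  "ogda_pair \<beta> x0 y0 =
     ds_ogda_pair X Y f (4 * L) (4 * L) (1 / (216 * L)) (1 / (216 * L)) \<beta> (1 / 20000) x0 y0"

lemma ogda_pair_simps:
  "ogda_pair \<beta> x0 y0 0 = ((x0, y0, x0, y0), (x0, y0, x0, y0))"
  "ogda_pair \<beta> x0 y0 (Suc t) = (snd (ogda_pair \<beta> x0 y0 t),
     ogda_next \<beta> (fst (ogda_pair \<beta> x0 y0 t)) (snd (ogda_pair \<beta> x0 y0 t)))"
  by (simp_all add: ogda_pair_def ogda_next_def split: prod.split)

lemma feasible_ogda_pair:
  assumes "x0 \<in> X" "y0 \<in> Y" "0 \<le> \<beta>" "\<beta> \<le> 1"
  shows "feasible_state (fst (ogda_pair \<beta> x0 y0 t)) \<and> feasible_state (snd (ogda_pair \<beta> x0 y0 t))"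
proof (induction t)
  case 0
  show ?case
    using assms by (simp add: ogda_pair_simps feasible_state_def)
next
  case (Suc t)
  then show ?case
    using assms by (simp add: ogda_pair_simps feasible_ogda_next)
qed

text \<open>The decrease from \<open>lyapunov_step\<close> with 2 / 160000 of the dual weight 3 /
  160000 set aside: this share absorbs the prox error up to O(1 / T) per step.\<close>

definition progress :: "real \<Rightarrow> 'a \<times> 'b \<times> 'a \<times> 'b \<Rightarrow> 'a \<times> 'b \<times> 'a \<times> 'b \<Rightarrow> real" where
  "progress \<beta> p c = \<beta> / 8 * (primal_shift (anchor c))\<^sup>2 + 1 / 160000 * (dual_shift (anchor c))\<^sup>2
     + 1 / 436 * tracking_energy p c"

lemma tracking_energy_nonneg: "0 \<le> tracking_energy p c"
  by (simp add: tracking_energy_def)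

lemma exists_small_progress:
  assumes x0: "x0 \<in> X" and y0: "y0 \<in> Y" and \<beta>: "0 \<le> \<beta>" "\<beta> \<le> 1 / 20000" and T: "T > 0"
    and gap: "\<And>w. w \<in> X \<times> Y \<Longrightarrow> 8 * \<beta> * (prox_error w)\<^sup>2 \<le> 1 / 80000 * ((dual_shift w)\<^sup>2 + 1 / real T)"
  defines "s0 \<equiv> (x0, y0, x0, y0)"
  shows "\<exists>t<T. progress \<beta> (fst (ogda_pair \<beta> x0 y0 t)) (snd (ogda_pair \<beta> x0 y0 t))
    \<le> (lyapunov s0 s0 - Inf (max_val Y f ` X) / (4 * L) + 1) / real T"
proof -
  define p c where "p t = fst (ogda_pair \<beta> x0 y0 t)" and "c t = snd (ogda_pair \<beta> x0 y0 t)" for t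
  have feas: "feasible_state (p t)" "feasible_state (c t)" for t
    using feasible_ogda_pair[OF x0 y0] \<beta> unfolding p_def c_def by auto
  have next_state: "p (Suc t) = c t" "c (Suc t) = ogda_next \<beta> (p t) (c t)" for t
    by (simp_all add: p_def c_def ogda_pair_simps)
  have "\<exists>t<T. progress \<beta> (p t) (c t) \<le> (lyapunov (p 0) (c 0) - Inf (max_val Y f ` X) / (4 * L) + 1 / 80000) / real T"
  proof (rule exists_small_decrement[OF T])
    fix t
    have "8 * \<beta> * (prox_error (anchor (c t)))\<^sup>2 \<le> 1 / 80000 * ((dual_shift (anchor (c t)))\<^sup>2 + 1 / real T)"
      using feas(2)[of t] by (intro gap) (simp add: feasible_state_def)
    with lyapunov_step[OF feas(1)[of t] feas(2)[of t] \<beta>]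
    show "lyapunov (p (Suc t)) (c (Suc t)) \<le> lyapunov (p t) (c t) - progress \<beta> (p t) (c t) + 1 / 80000 / real T"
      unfolding next_state progress_def by argo
  next
    show "Inf (max_val Y f ` X) / (4 * L) \<le> lyapunov (p T) (c T)"
      unfolding lyapunov_def using potential_lower_bound[of "anchor (c T)"] tracking_energy_nonneg[of "p T" "c T"]
      by simp
  qed
  then obtain t where t: "t < T"
    "progress \<beta> (p t) (c t) \<le> (lyapunov (p 0) (c 0) - Inf (max_val Y f ` X) / (4 * L) + 1 / 80000) / real T"
    by blast
  moreover have "p 0 = s0" "c 0 = s0"
    by (simp_all add: p_def c_def s0_def ogda_pair_simps)
  moreover have "(lyapunov s0 s0 - Inf (max_val Y f ` X) / (4 * L) + 1 / 80000) / real T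
      \<le> (lyapunov s0 s0 - Inf (max_val Y f ` X) / (4 * L) + 1) / real T"
    by (intro divide_right_mono) auto
  ultimately show ?thesis
    unfolding p_def c_def by fastforce
qed

lemma norm_anchor_step_le:
  assumes "0 \<le> \<beta>" "\<beta> \<le> 1"
  shows "norm (anchor (ogda_next \<beta> p c) - anchor c) \<le> norm (primal_dual c - anchor c)"
proof -
  have "(norm (\<beta> *\<^sub>R (fst (primal_dual c) - fst (anchor c))))\<^sup>2 \<le> (norm (fst (primal_dual c) - fst (anchor c)))\<^sup>2"
    using assms by (intro power_mono) (auto simp: mult_left_le_one_le)
  moreover have "(norm ((1 / 20000) *\<^sub>R (snd (primal_dual c) - snd (anchor c))))\<^sup>2
      \<le> (norm (snd (primal_dual c) - snd (anchor c)))\<^sup>2"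
    by (intro power_mono) (auto simp: mult_left_le_one_le)
  moreover have "primal_dual c - anchor c = (fst (primal_dual c) - fst (anchor c), snd (primal_dual c) - snd (anchor c))"
    by (simp add: prod_eq_iff)
  ultimately show ?thesis
    unfolding anchor_ogda_next by (simp only: norm_Pair real_sqrt_le_iff add_mono)
qed

text \<open>The projection residual divided by the step size lies in the normal cones at the new
  point; added to \<open>saddle_field\<close> it leaves the extrapolation error, the movement of the
  iterate and the anchor term 4 L (h - w). The weights 216 and 6 of the movement give 222.\<close>

lemma game_stationary_next:
  assumes p: "feasible_state p" and c: "feasible_state c" and \<beta>: "0 \<le> \<beta>" "\<beta> \<le> 1"
  defines "h \<equiv> primal_dual (ogda_next \<beta> p c)"
  shows "game_stationary X Y f (L * (222 * norm (h - primal_dual c) + 6 * norm (primal_dual c - primal_dual p)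
    + 4 * norm (anchor c - anchor p) + 4 * norm (h - anchor c))) (fst h) (snd h)"
proof -
  let ?H = "regularized_field (anchor c) h"
  have h: "h \<in> X \<times> Y"
    using feasible_ogda_next[OF c \<beta>] unfolding h_def feasible_state_def by blast
  define \<nu> where "\<nu> = (216 * L) *\<^sub>R (primal_dual c - (1 / (216 * L)) *\<^sub>R extrapolated_field p c - h)"
  have normal: "\<nu> \<bullet> (q - h) \<le> 0" if "q \<in> X \<times> Y" for q
    using ogda_next_projection[OF that, of c p \<beta>] L by (simp add: \<nu>_def h_def mult_le_0_iff)
  have "fst \<nu> \<bullet> (x - fst h) \<le> 0" if "x \<in> X" for x
    using normal[of "(x, snd h)"] h that by (simp add: inner_prod_def mem_Times_iff)
  then have nx: "fst \<nu> \<in> normal_cone X (fst h)"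
    using h by (auto simp: normal_cone_def)
  have "snd \<nu> \<bullet> (y - snd h) \<le> 0" if "y \<in> Y" for y
    using normal[of "(fst h, y)"] h that by (simp add: inner_prod_def mem_Times_iff)
  then have ny: "snd \<nu> \<in> normal_cone Y (snd h)"
    using h by (auto simp: normal_cone_def)
  define R where "R = saddle_field h + \<nu>"
  have "stat_dist X (grad_x f (fst h) (snd h)) (fst h) \<le> norm (fst R)"
    unfolding stat_dist_def using infdist_le[OF imageI[OF nx], of 0 "\<lambda>u. grad_x f (fst h) (snd h) + u"]
    by (simp add: R_def saddle_field_def)
  moreover have "stat_dist Y (- grad_y f (fst h) (snd h)) (snd h) \<le> norm (snd R)"
    unfolding stat_dist_def using infdist_le[OF imageI[OF ny], of 0 "\<lambda>u. - grad_y f (fst h) (snd h) + u"]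
    by (simp add: R_def saddle_field_def)
  moreover have "norm (fst R) \<le> norm R" "norm (snd R) \<le> norm R"
    by (metis norm_fst_le prod.collapse, metis norm_snd_le prod.collapse)
  moreover have "norm R \<le> L * (222 * norm (h - primal_dual c) + 6 * norm (primal_dual c - primal_dual p)
    + 4 * norm (anchor c - anchor p) + 4 * norm (h - anchor c))"
  proof -
    have R: "R = - (extrapolated_field p c - ?H) - (216 * L) *\<^sub>R (h - primal_dual c) - (4 * L) *\<^sub>R (h - anchor c)"
      using L by (simp add: R_def \<nu>_def regularized_field_def scaleR_diff_right)
    have "norm R \<le> norm (extrapolated_field p c - ?H) + norm ((216 * L) *\<^sub>R (h - primal_dual c))
        + norm ((4 * L) *\<^sub>R (h - anchor c))"
      unfolding R
      by (rule order_trans[OF norm_triangle_ineq4 add_right_mono[OF order_trans[OF norm_triangle_ineq4]]])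
        (simp add: norm_minus_commute)
    also have "\<dots> \<le> (6 * L * norm (h - primal_dual c) + 6 * L * norm (primal_dual c - primal_dual p)
        + 4 * L * norm (anchor c - anchor p)) + 216 * L * norm (h - primal_dual c) + 4 * L * norm (h - anchor c)"
      using extrapolation_error[OF p c h] L by simp
    finally show ?thesis
      by (simp add: algebra_simps)
  qed
  ultimately show ?thesis
    unfolding game_stationary_def using h by auto
qed

text \<open>\<open>progress\<close> weights the squared primal shift by \<beta>, so that square is
  only of order 1 / (T \<beta>), while its other squares are of order 1 / T. Up to constants,
  \<open>\<kappa>\<close> bounds all distances; the absolute value of \<open>M\<close> makes the
  radicand nonnegative.\<close>

lemma exists_stationary_iterate:
  assumes x0: "x0 \<in> X" and y0: "y0 \<in> Y" and r: "r > L"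
    and \<beta>: "0 < \<beta>" "\<beta> \<le> 1 / 20000" and T: "T > 0"
    and gap: "\<And>w. w \<in> X \<times> Y \<Longrightarrow> 8 * \<beta> * (prox_error w)\<^sup>2 \<le> 1 / 80000 * ((dual_shift w)\<^sup>2 + 1 / real T)"
  defines "s0 \<equiv> (x0, y0, x0, y0)"
  defines "M \<equiv> lyapunov s0 s0 - Inf (max_val Y f ` X) / (4 * L) + 1"
  defines "\<kappa> \<equiv> sqrt ((160000 * \<bar>M\<bar> + 1) / (real T * \<beta>))"
  shows "\<exists>t<T. case ds_ogda X Y f (4 * L) (4 * L) (1 / (216 * L)) (1 / (216 * L)) \<beta> (1 / 20000) x0 y0 (Suc t) of
    (x, y, z, v) \<Rightarrow> game_stationary X Y f (500 * L * \<kappa>) x y \<and>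
      opt_stationary X Y f r ((1 + 3 * L / (r - L)) * (11 * \<kappa>)) z"
proof -
  obtain t where t: "t < T"
    and pr: "progress \<beta> (fst (ogda_pair \<beta> x0 y0 t)) (snd (ogda_pair \<beta> x0 y0 t)) \<le> M / real T"
    using exists_small_progress[OF x0 y0 _ \<beta>(2) T gap] \<beta>(1) unfolding M_def s0_def by force
  define p c where "p = fst (ogda_pair \<beta> x0 y0 t)" and "c = snd (ogda_pair \<beta> x0 y0 t)"
  have \<beta>': "0 \<le> \<beta>" "\<beta> \<le> 1"
    using \<beta> by auto
  have p: "feasible_state p" and c: "feasible_state c"
    using feasible_ogda_pair[OF x0 y0 \<beta>'] unfolding p_def c_def by auto
  define n where "n = ogda_next \<beta> p c"
  define h where "h = primal_dual n"
  have n: "feasible_state n"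
    unfolding n_def by (rule feasible_ogda_next[OF c \<beta>'])
  define w where "w = anchor c"
  have w: "w \<in> X \<times> Y"
    using c by (simp add: w_def feasible_state_def)
  define N where "N = \<bar>M\<bar> / real T"
  have N: "0 \<le> N" "M / real T \<le> N"
    by (auto simp: N_def divide_right_mono)
  define Q where "Q = (160000 * \<bar>M\<bar> + 1) / (real T * \<beta>)"
  \<comment> \<open>\<open>Q\<close> is the square of \<open>\<kappa>\<close>; bounds of order 1 / T
    become multiples of \<beta> Q, hence of \<open>Q\<close> since \<beta> \<le> 1.\<close>
  have Q: "160000 * N + 1 / real T = \<beta> * Q"
    using T \<beta> by (simp add: Q_def N_def field_simps)
  have Q0: "0 \<le> Q"
    using \<beta> by (simp add: Q_def)
  then have Q1: "\<beta> * Q \<le> Q"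
    using \<beta>' by (simp add: mult_left_le_one_le)
  have Ti: "0 < 1 / real T"
    using T by simp
  have sq: "a \<le> \<kappa>" if "a\<^sup>2 \<le> Q" for a
    using that by (simp add: \<kappa>_def Q_def real_le_rsqrt)
  have pos: "0 \<le> \<beta> * (primal_shift w)\<^sup>2" "0 \<le> (dual_shift w)\<^sup>2" "0 \<le> tracking_energy p c"
    using \<beta> tracking_energy_nonneg by auto
  have "progress \<beta> p c \<le> N"
    using pr N unfolding p_def c_def by simp
  then have P: "\<beta> / 8 * (primal_shift w)\<^sup>2 + 1 / 160000 * (dual_shift w)\<^sup>2 + 1 / 436 * tracking_energy p c \<le> N"
    unfolding progress_def w_def .
  then have "\<beta> * (primal_shift w)\<^sup>2 \<le> \<beta> * Q"
    using pos N Ti unfolding Q[symmetric] by argo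
  then have a: "primal_shift w \<le> \<kappa>"
    using \<beta> by (intro sq) simp
  have s2: "(dual_shift w)\<^sup>2 \<le> 160000 * N"
    using P pos by argo
  then have s: "dual_shift w \<le> \<kappa>"
    using Q Q1 Ti by (intro sq) linarith
  have V: "tracking_energy p c \<le> 436 * N"
    using P pos by argo
  \<comment> \<open>The squared dual shift is already of order 1 / T, so the gap hypothesis bounds
    the prox error itself.\<close>
  have "8 * \<beta> * (prox_error w)\<^sup>2 \<le> 1 / 80000 * (\<beta> * Q)"
    using gap[OF w] s2 Q by argo
  also have "\<dots> \<le> 8 * \<beta> * Q"
    using \<beta> Q0 by simp
  finally have g: "prox_error w \<le> \<kappa>"
    using \<beta> by (intro sq) simp
  define e d \<omega> d' where "e = norm (primal_dual c - saddle w)"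
    and "d = norm (primal_dual c - primal_dual p)" and "\<omega> = norm (w - anchor p)"
    and "d' = norm (h - primal_dual c)"
  have V': "e\<^sup>2 + 1 / 2 * d\<^sup>2 + 1 / 2 * \<omega>\<^sup>2 \<le> 436 * N"
    using V unfolding tracking_energy_def e_def d_def \<omega>_def w_def .
  have sqpos: "0 \<le> e\<^sup>2" "0 \<le> d\<^sup>2" "0 \<le> \<omega>\<^sup>2"
    by auto
  have e2: "e\<^sup>2 \<le> Q" and d2: "d\<^sup>2 \<le> Q" and \<omega>2: "\<omega>\<^sup>2 \<le> Q"
    using V' sqpos Q Q1 Ti N by argo+
  have e: "e \<le> \<kappa>" and d: "d \<le> \<kappa>" and \<omega>: "\<omega> \<le> \<kappa>"
    using e2 d2 \<omega>2 by (auto intro: sq)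
  have "109 / 108 * (norm (h - saddle w))\<^sup>2 + 3 / 4 * d'\<^sup>2 \<le> e\<^sup>2 + 1 / 4 * d\<^sup>2 + 1 / 4 * \<omega>\<^sup>2"
    unfolding h_def n_def e_def d_def \<omega>_def d'_def w_def by (rule ogda_next_contraction[OF p c \<beta>'])
  moreover have "0 \<le> (norm (h - saddle w))\<^sup>2"
    by simp
  moreover have "(d' / 2)\<^sup>2 = d'\<^sup>2 / 4"
    by (simp add: power_divide)
  ultimately have "(d' / 2)\<^sup>2 \<le> Q"
    using e2 d2 \<omega>2 Q0 by argo
  then have d': "d' \<le> 2 * \<kappa>"
    using sq[of "d' / 2"] by simp
  have sw: "norm (saddle w - w) \<le> primal_shift w + dual_shift w"
    unfolding primal_shift_def dual_shift_def
    by (metis fst_diff snd_diff norm_Pair_le prod.collapse)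
  have uw: "norm (primal_dual c - w) \<le> 3 * \<kappa>"
    using norm_triangle_ineq[of "primal_dual c - saddle w" "saddle w - w"] sw a s e by (simp add: e_def)
  have hw: "norm (h - w) \<le> 5 * \<kappa>"
    using norm_triangle_ineq[of "h - primal_dual c" "primal_dual c - w"] uw d' by (simp add: d'_def)
  have "game_stationary X Y f (L * (222 * d' + 6 * d + 4 * \<omega> + 4 * norm (h - w))) (fst h) (snd h)"
    unfolding h_def n_def d_def \<omega>_def d'_def w_def by (rule game_stationary_next[OF p c \<beta>'])
  then have game: "game_stationary X Y f (500 * L * \<kappa>) (fst h) (snd h)"
  proof (rule game_stationary_mono)
    \<comment> \<open>Numerically 222 * 2 + 6 + 4 + 4 * 5 = 474.\<close>
    have "222 * d' + 6 * d + 4 * \<omega> + 4 * norm (h - w) \<le> 500 * \<kappa>"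
      using d' d \<omega> hw norm_ge_zero[of "h - w"] by linarith
    then show "L * (222 * d' + 6 * d + 4 * \<omega> + 4 * norm (h - w)) \<le> 500 * L * \<kappa>"
      using L mult_left_mono by fastforce
  qed
  define z z' where "z = fst w" and "z' = fst (anchor n)"
  have z': "z' \<in> X"
    using n by (auto simp: z'_def feasible_state_def mem_Times_iff)
  have "norm (z' - z) \<le> norm (anchor n - w)"
    unfolding z_def z'_def by (metis fst_diff norm_fst_le prod.collapse)
  also have "\<dots> \<le> norm (primal_dual c - w)"
    unfolding n_def w_def by (rule norm_anchor_step_le[OF \<beta>'])
  finally have dz: "norm (z' - z) \<le> 3 * \<kappa>"
    using uw by simp
  \<comment> \<open>The estimates concern the anchor \<open>z\<close> before the step, the claim the
    one after it; Lipschitz continuity of the proximal point carries the residual over, with 4 + 2 +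
    3 \<le> 11.\<close>
  have "norm (prox_point (4 * L) z - z) \<le> 2 * \<kappa>"
    using norm_triangle_ineq4[of "fst (saddle w) - z" "fst (saddle w) - prox_point (4 * L) z"] a g
    by (simp add: primal_shift_def prox_error_def z_def)
  moreover have "norm (prox_point (4 * L) z' - prox_point (4 * L) z) \<le> 4 / 3 * norm (z' - z)"
    by (rule prox_point_lipschitz)
  moreover have "norm (prox_point (4 * L) z' - z')
      \<le> norm (prox_point (4 * L) z' - prox_point (4 * L) z) + norm (prox_point (4 * L) z - z) + norm (z' - z)"
    using norm_triangle_ineq[of "prox_point (4 * L) z' - prox_point (4 * L) z" "prox_point (4 * L) z - z"]
      norm_triangle_ineq4[of "prox_point (4 * L) z' - z" "z' - z"] by simp
  ultimately have "norm (prox_point (4 * L) z' - z') \<le> 11 * \<kappa>"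
    using dz norm_ge_zero[of "z' - z"] by linarith
  moreover have "norm (prox_point r z' - z') \<le> (1 + 3 * L / (r - L)) * norm (prox_point (4 * L) z' - z')"
    by (rule prox_residual_change_parameter[OF r])
  moreover have "0 \<le> 1 + 3 * L / (r - L)"
    using r L by simp
  ultimately have opt: "opt_stationary X Y f r ((1 + 3 * L / (r - L)) * (11 * \<kappa>)) z'"
    unfolding opt_stationary_def using z' by (meson mult_left_mono order_trans)
  have "ds_ogda X Y f (4 * L) (4 * L) (1 / (216 * L)) (1 / (216 * L)) \<beta> (1 / 20000) x0 y0 (Suc t) = n"
    unfolding ds_ogda_def ogda_pair_def[symmetric] ogda_pair_simps n_def p_def c_def by simp
  then show ?thesis
    using t game opt by (intro exI[of _ t]) (simp add: h_def z'_def split_def)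
qed

text \<open>The common form of both cases; \<theta> = 1 covers the concave one. \<beta> is fixed
  from K, \<theta> and the diameter of Y, before the starting point and r are given.\<close>

lemma convergence_rate:
  fixes \<theta> K :: real
  assumes \<theta>: "0 < \<theta>" "\<theta> \<le> 1" and K: "0 \<le> K"
    and gap: "\<And>w. w \<in> X \<times> Y \<Longrightarrow> saddle_gap w \<le> K * dual_shift w powr (1 / \<theta>)"
  shows "\<exists>\<beta> :: nat \<Rightarrow> real. (\<forall>T>1. 0 < \<beta> T \<and> \<beta> T < 1) \<and>
    \<beta> \<in> O(\<lambda>T. real T powr (- (max (2 * \<theta> - 1) 0 / (2 * \<theta>)))) \<and>
    (\<forall>x0\<in>X. \<forall>y0\<in>Y. \<forall>r>L. \<exists>\<epsilon> \<delta> :: nat \<Rightarrow> real.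
      \<epsilon> \<in> O(\<lambda>T. real T powr (- (1 / (max (4 * \<theta> - 2) 0 + 2)))) \<and>
      \<delta> \<in> O(\<lambda>T. real T powr (- (1 / (max (4 * \<theta> - 2) 0 + 2)))) \<and>
      (\<forall>T>1. \<exists>t<T.
        case ds_ogda X Y f (4 * L) (4 * L) (1 / (216 * L)) (1 / (216 * L)) (\<beta> T) (1 / 20000) x0 y0 (Suc t) of
          (x, y, z, v) \<Rightarrow> game_stationary X Y f (\<epsilon> T) x y \<and> opt_stationary X Y f r (\<delta> T) z))"
proof -
  define \<alpha> where "\<alpha> = max (2 * \<theta> - 1) 0 / (2 * \<theta>)"
  define \<gamma> where "\<gamma> = 1 / (max (4 * \<theta> - 2) 0 + 2)"
  \<comment> \<open>With \<beta> of order T^(-\<alpha>), the product T \<beta> has order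
    T^(2\<gamma>), so \<open>\<kappa>\<close> has order T^(-\<gamma>).\<close>
  have \<alpha>\<gamma>: "1 - \<alpha> = 2 * \<gamma>"
    using \<theta> unfolding \<alpha>_def \<gamma>_def by (auto simp: max_def field_simps)
  have \<alpha>0: "0 \<le> \<alpha>"
    using \<theta> by (simp add: \<alpha>_def)
  obtain K' where K': "K' \<ge> 0" "\<And>T s. 1 < T \<Longrightarrow> 0 \<le> s \<Longrightarrow> s \<le> diameter Y \<Longrightarrow>
      real T powr (- \<alpha>) * s powr (1 / \<theta>) \<le> K' * (s\<^sup>2 + 1 / real T)"
    using powr_rate_bound[OF \<theta>(1) diameter_ge_0[OF compact_imp_bounded[OF Y(2)]]] unfolding \<alpha>_def by metis
  \<comment> \<open>Ensures c K K' \<le> 1 / 700000, which suffices because 8 / 700000 \<le> 1 /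
    80000; the added 1 avoids division by zero and keeps \<beta> below 1 / 20000.\<close>
  define c where "c = 1 / (700000 * (K * K' + 1))"
  have KK: "0 \<le> K * K'"
    using K K' by simp
  have c: "0 < c" "c \<le> 1 / 700000" "c * (K * K') \<le> 1 / 700000"
    using KK by (auto simp: c_def field_simps)
  define \<beta> where "\<beta> T = c * real T powr (- \<alpha>)" for T :: nat
  have \<beta>: "0 < \<beta> T" "\<beta> T \<le> 1 / 20000" if "1 < T" for T
  proof -
    have "real T powr (- \<alpha>) \<le> real T powr 0"
      using that \<alpha>0 by (intro powr_mono) auto
    then have "\<beta> T \<le> c * 1"
      unfolding \<beta>_def using c that by (intro mult_left_mono) auto
    then show "\<beta> T \<le> 1 / 20000"
      using c by simp
    show "0 < \<beta> T"
      using c that by (simp add: \<beta>_def)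
  qed
  have prox_bound: "8 * \<beta> T * (prox_error w)\<^sup>2 \<le> 1 / 80000 * ((dual_shift w)\<^sup>2 + 1 / real T)"
    if T: "1 < T" and w: "w \<in> X \<times> Y" for T w
  proof -
    have "dual_shift w \<le> diameter Y"
      unfolding dual_shift_def dist_norm[symmetric]
      using w Y by (intro diameter_bounded_bound saddle_in compact_imp_bounded) auto
    then have K'w: "real T powr (- \<alpha>) * dual_shift w powr (1 / \<theta>) \<le> K' * ((dual_shift w)\<^sup>2 + 1 / real T)"
      by (intro K'(2) T) (simp add: dual_shift_def)
    have "(prox_error w)\<^sup>2 \<le> L * (prox_error w)\<^sup>2"
      using mult_right_mono[OF L, of "(prox_error w)\<^sup>2"] by simp
    also have "\<dots> \<le> 3 / 2 * L * (prox_error w)\<^sup>2"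
      using L by (intro mult_right_mono) auto
    also have "\<dots> \<le> saddle_gap w"
      unfolding prox_error_def by (rule prox_error_le_gap)
    also have "\<dots> \<le> K * dual_shift w powr (1 / \<theta>)"
      by (rule gap[OF w])
    finally have "\<beta> T * (prox_error w)\<^sup>2 \<le> \<beta> T * (K * dual_shift w powr (1 / \<theta>))"
      using \<beta>[OF T] by (intro mult_left_mono) auto
    also have "\<dots> = c * K * (real T powr (- \<alpha>) * dual_shift w powr (1 / \<theta>))"
      by (simp add: \<beta>_def)
    also have "\<dots> \<le> c * K * (K' * ((dual_shift w)\<^sup>2 + 1 / real T))"
      using K'w c K by (intro mult_left_mono) auto
    also have "\<dots> = c * (K * K') * ((dual_shift w)\<^sup>2 + 1 / real T)"
      by simp
    also have "\<dots> \<le> 1 / 700000 * ((dual_shift w)\<^sup>2 + 1 / real T)"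
      using c by (intro mult_right_mono) auto
    finally have "8 * \<beta> T * (prox_error w)\<^sup>2 \<le> 8 / 700000 * ((dual_shift w)\<^sup>2 + 1 / real T)"
      by simp
    also have "\<dots> \<le> 1 / 80000 * ((dual_shift w)\<^sup>2 + 1 / real T)"
      by (intro mult_right_mono) auto
    finally show ?thesis .
  qed
  have "\<exists>\<epsilon> \<delta> :: nat \<Rightarrow> real. \<epsilon> \<in> O(\<lambda>T. real T powr (- \<gamma>)) \<and> \<delta> \<in> O(\<lambda>T. real T powr (- \<gamma>)) \<and>
      (\<forall>T>1. \<exists>t<T.
        case ds_ogda X Y f (4 * L) (4 * L) (1 / (216 * L)) (1 / (216 * L)) (\<beta> T) (1 / 20000) x0 y0 (Suc t) of
          (x, y, z, v) \<Rightarrow> game_stationary X Y f (\<epsilon> T) x y \<and> opt_stationary X Y f r (\<delta> T) z)"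
    if x0: "x0 \<in> X" and y0: "y0 \<in> Y" and r: "r > L" for x0 y0 r
  proof -
    define s0 where "s0 = (x0, y0, x0, y0)"
    define B where "B = 160000 * \<bar>lyapunov s0 s0 - Inf (max_val Y f ` X) / (4 * L) + 1\<bar> + 1"
    define \<kappa> where "\<kappa> T = sqrt (B / (real T * \<beta> T))" for T :: nat
    have \<kappa>: "\<kappa> T = sqrt (B / c) * real T powr (- \<gamma>)" if "1 < T" for T
    proof -
      have "real T * \<beta> T = c * (real T powr (1 - \<alpha>))"
        using that by (simp add: \<beta>_def powr_diff powr_minus field_simps)
      also have "\<dots> = c * (real T powr \<gamma>)\<^sup>2"
        using that by (simp add: \<alpha>\<gamma> powr_powr mult.commute flip: powr_numeral)
      finally show ?thesis
        using that by (simp add: \<kappa>_def real_sqrt_divide real_sqrt_mult powr_minus_divide)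
    qed
    have "eventually (\<lambda>T. \<kappa> T = sqrt (B / c) * real T powr (- \<gamma>)) at_top"
      using eventually_gt_at_top[of 1] by eventually_elim (rule \<kappa>)
    then have \<kappa>O: "\<kappa> \<in> O(\<lambda>T. real T powr (- \<gamma>))"
      by (subst landau_o.big.in_cong) auto
    have cmult: "(\<lambda>T. a * \<kappa> T) \<in> O(\<lambda>T. real T powr (- \<gamma>))" for a
      using \<kappa>O by (cases "a = 0") auto
    show ?thesis
    proof (rule exI[of _ "\<lambda>T. 500 * L * \<kappa> T"], rule exI[of _ "\<lambda>T. (1 + 3 * L / (r - L)) * (11 * \<kappa> T)"],
        intro conjI allI impI)
      show "(\<lambda>T. 500 * L * \<kappa> T) \<in> O(\<lambda>T. real T powr (- \<gamma>))"
        by (rule cmult)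
      show "(\<lambda>T. (1 + 3 * L / (r - L)) * (11 * \<kappa> T)) \<in> O(\<lambda>T. real T powr (- \<gamma>))"
        using cmult[of "(1 + 3 * L / (r - L)) * 11"] by (simp only: mult.assoc)
      fix T :: nat assume T: "1 < T"
      show "\<exists>t<T. case ds_ogda X Y f (4 * L) (4 * L) (1 / (216 * L)) (1 / (216 * L)) (\<beta> T) (1 / 20000) x0 y0 (Suc t) of
          (x, y, z, v) \<Rightarrow> game_stationary X Y f (500 * L * \<kappa> T) x y \<and>
            opt_stationary X Y f r ((1 + 3 * L / (r - L)) * (11 * \<kappa> T)) z"
        using exists_stationary_iterate[OF x0 y0 r \<beta>[OF T] _ prox_bound[OF T]] T
        unfolding \<kappa>_def B_def s0_def by simp
    qed
  qed
  moreover have "\<beta> \<in> O(\<lambda>T. real T powr (- \<alpha>))"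
    unfolding \<beta>_def by simp
  moreover have "0 < \<beta> T \<and> \<beta> T < 1" if "1 < T" for T
    using \<beta>[OF that] by simp
  ultimately show ?thesis
    unfolding \<alpha>_def[symmetric] \<gamma>_def[symmetric] by blast
qed

section \<open>The dual gap at the saddle point in the two cases\<close>

lemma saddle_normal:
  "grad_y f (fst (saddle w)) (snd (saddle w)) - (4 * L) *\<^sub>R (snd (saddle w) - snd w) \<in> normal_cone Y (snd (saddle w))"
  unfolding normal_cone_def using saddle_vi_y[of _ w] saddle_in[of w] by blast

lemma stat_dist_saddle:
  "stat_dist Y (- grad_y f (fst (saddle w)) (snd (saddle w))) (snd (saddle w)) \<le> 4 * L * dual_shift w"
  unfolding stat_dist_def dual_shift_def
  using infdist_le[OF imageI[OF saddle_normal], of 0 "\<lambda>u. - grad_y f (fst (saddle w)) (snd (saddle w)) + u" w] L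
  by simp

text \<open>The tangent inequality bounds the gap by an inner product with the gradient; the
  variational inequality replaces the gradient by 4 L times the dual displacement, and the other
  factor is at most the diameter.\<close>

lemma concave_saddle_gap:
  assumes "\<forall>x\<in>X. concave_on Y (f x)"
  shows "saddle_gap w \<le> 4 * L * diameter Y * dual_shift w"
proof -
  let ?x = "fst (saddle w)" and ?y = "snd (saddle w)"
  have "max_val Y f ?x \<le> f ?x ?y + 4 * L * diameter Y * dual_shift w"
  proof (rule max_val_le)
    fix y assume y: "y \<in> Y"
    have "f ?x y - f ?x ?y \<le> grad_y f ?x ?y \<bullet> (y - ?y)"
      using assms saddle_in y by (intro concave_on_above_tangent[OF _ _ _ GDERIV_y]) auto
    also have "\<dots> \<le> 4 * L * ((?y - snd w) \<bullet> (y - ?y))"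
      using saddle_vi_y[OF y, of w] by (simp add: inner_diff_left)
    also have "\<dots> \<le> 4 * L * (norm (?y - snd w) * norm (y - ?y))"
      using L norm_cauchy_schwarz by (intro mult_left_mono) auto
    also have "\<dots> \<le> 4 * L * (dual_shift w * diameter Y)"
      unfolding dual_shift_def dist_norm[symmetric] using L Y y
      by (intro mult_left_mono diameter_bounded_bound saddle_in compact_imp_bounded) auto
    finally show "f ?x y \<le> f ?x ?y + 4 * L * diameter Y * dual_shift w"
      by (simp add: algebra_simps)
  qed
  then show ?thesis
    by (simp add: saddle_gap_def)
qed

text \<open>The KL inequality is applied at the saddle point, whose dual stationarity measure is at
  most 4 L times the dual shift; the power 1/\<theta> then isolates the nonnegative gap.\<close>

lemma KL_saddle_gap:
  assumes \<theta>: "0 < \<theta>" and KL: "dual_KL X Y f \<theta>"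
  obtains K where "K \<ge> 0" "\<And>w. saddle_gap w \<le> K * dual_shift w powr (1 / \<theta>)"
proof -
  obtain \<tau> where \<tau>: "\<tau> > 0" "\<And>x y. x \<in> X \<Longrightarrow> y \<in> Y \<Longrightarrow>
      (max_val Y f x - f x y) powr \<theta> \<le> 1 / \<tau> * stat_dist Y (- grad_y f x y) y"
    using KL unfolding dual_KL_def by blast
  have "saddle_gap w \<le> (4 * L / \<tau>) powr (1 / \<theta>) * dual_shift w powr (1 / \<theta>)" for w
  proof -
    have "saddle_gap w powr \<theta> \<le> 1 / \<tau> * (4 * L * dual_shift w)"
      unfolding saddle_gap_def using \<tau>
      by (intro order_trans[OF \<tau>(2)] mult_left_mono stat_dist_saddle saddle_in) auto
    then have "(saddle_gap w powr \<theta>) powr (1 / \<theta>) \<le> (4 * L / \<tau> * dual_shift w) powr (1 / \<theta>)"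
      using \<theta> by (intro powr_mono2) auto
    also have "\<dots> = (4 * L / \<tau>) powr (1 / \<theta>) * dual_shift w powr (1 / \<theta>)"
      by (rule powr_mult)
    also have "(saddle_gap w powr \<theta>) powr (1 / \<theta>) = saddle_gap w"
      using \<theta> saddle_gap_nonneg[of w] by (simp add: powr_powr)
    finally show ?thesis .
  qed
  then show ?thesis
    using that[of "(4 * L / \<tau>) powr (1 / \<theta>)"] by simp
qed

end

section \<open>Choice of the parameters and reduction of both cases to one rate\<close>

theorem theorem2p3:
  fixes X :: "(real ^ 'n) set" and Y :: "(real ^ 'd) set"
    and f :: "real ^ 'n \<Rightarrow> real ^ 'd \<Rightarrow> real" and L :: real
  assumes "Y \<noteq> {}" "compact Y" "convex Y"
    and "X \<noteq> {}" "closed X" "convex X"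
    and "cont_differentiable (\<lambda>(x, y). f x y)"
    and "L \<ge> 1" "lipschitz_grads L X Y f"
  shows "\<exists>rx ry \<eta>x \<eta>y \<beta>y :: nat \<Rightarrow> real.
    (\<forall>T>1. 0 < rx T \<and> 0 < ry T \<and> 0 < \<eta>x T \<and> 0 < \<eta>y T \<and> 0 < \<beta>y T \<and> \<beta>y T < 1) \<and>
    rx \<in> O(\<lambda>_. 1) \<and> ry \<in> O(\<lambda>_. 1) \<and> \<eta>x \<in> O(\<lambda>_. 1) \<and> \<eta>y \<in> O(\<lambda>_. 1) \<and> \<beta>y \<in> O(\<lambda>_. 1) \<and>
    ((\<forall>x\<in>X. concave_on Y (f x)) \<and> bdd_below (max_val Y f ` X) \<longrightarrow>
      (\<exists>\<beta>x :: nat \<Rightarrow> real.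
        (\<forall>T>1. 0 < \<beta>x T \<and> \<beta>x T < 1) \<and>
        \<beta>x \<in> O(\<lambda>T. real T powr (- 1 / 2)) \<and>
        (\<forall>x0\<in>X. \<forall>y0\<in>Y. \<forall>r>L. \<exists>\<epsilon> \<delta> :: nat \<Rightarrow> real.
          \<epsilon> \<in> O(\<lambda>T. real T powr (- 1 / 4)) \<and>
          \<delta> \<in> O(\<lambda>T. real T powr (- 1 / 4)) \<and>
          (\<forall>T>1. \<exists>t<T.
            case ds_ogda X Y f (rx T) (ry T) (\<eta>x T) (\<eta>y T) (\<beta>x T) (\<beta>y T) x0 y0 (Suc t) of
              (x, y, z, v) \<Rightarrow>
                game_stationary X Y f (\<epsilon> T) x y \<and> opt_stationary X Y f r (\<delta> T) z)))) \<and>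
    (\<forall>\<theta>. 0 < \<theta> \<and> \<theta> < 1 \<and> dual_KL X Y f \<theta> \<and> compact X \<longrightarrow>
      (\<exists>\<beta>x :: nat \<Rightarrow> real.
        (\<forall>T>1. 0 < \<beta>x T \<and> \<beta>x T < 1) \<and>
        \<beta>x \<in> O(\<lambda>T. real T powr (- (max (2 * \<theta> - 1) 0 / (2 * \<theta>)))) \<and>
        (\<forall>x0\<in>X. \<forall>y0\<in>Y. \<forall>r>L. \<exists>\<epsilon> \<delta> :: nat \<Rightarrow> real.
          \<epsilon> \<in> O(\<lambda>T. real T powr (- (1 / (max (4 * \<theta> - 2) 0 + 2)))) \<and>
          \<delta> \<in> O(\<lambda>T. real T powr (- (1 / (max (4 * \<theta> - 2) 0 + 2)))) \<and>
          (\<forall>T>1. \<exists>t<T.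
            case ds_ogda X Y f (rx T) (ry T) (\<eta>x T) (\<eta>y T) (\<beta>x T) (\<beta>y T) x0 y0 (Suc t) of
              (x, y, z, v) \<Rightarrow>
                game_stationary X Y f (\<epsilon> T) x y \<and> opt_stationary X Y f r (\<delta> T) z))))"
proof -
  interpret minimax_problem X Y f L
    using assms by unfold_locales
  show ?thesis
  \<comment> \<open>Only \<open>\<beta>x\<close> varies with T. The first eleven goals are
    positivity and boundedness of the constants; goals 12 and 13 are the concave and the KL
    case.\<close>
  proof (rule exI[of _ "\<lambda>_. 4 * L"], rule exI[of _ "\<lambda>_. 4 * L"], rule exI[of _ "\<lambda>_. 1 / (216 * L)"],
      rule exI[of _ "\<lambda>_. 1 / (216 * L)"], rule exI[of _ "\<lambda>_. 1 / 20000"], intro conjI impI allI, goal_cases)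
    case 12
    then interpret bounded_minimax_problem X Y f L
      by unfold_locales auto
    \<comment> \<open>A gap linear in the dual shift is the bound with \<theta> = 1, for which the
      exponents become 1/2 and 1/4.\<close>
    have "saddle_gap w \<le> 4 * L * diameter Y * dual_shift w powr (1 / 1)" for w
      using concave_saddle_gap[of w] 12 by (simp add: dual_shift_def)
    moreover have "0 \<le> 4 * L * diameter Y"
      using L diameter_ge_0[OF compact_imp_bounded[OF Y(2)]] by simp
    moreover have exponents: "- (max (2 * 1 - 1) 0 / (2 * 1)) = (- 1 / 2 :: real)"
        "- (1 / (max (4 * 1 - 2) 0 + 2)) = (- 1 / 4 :: real)"
      by simp_all
    ultimately show ?case
      by (intro convergence_rate[of 1 "4 * L * diameter Y", unfolded exponents] zero_less_one order_refl) simp_all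
  next
    case (13 \<theta>)
    \<comment> \<open>For a fixed y, \<open>f x y\<close> minorizes \<open>max_val\<close> and is
      bounded below on the compact set X; this supplies the hypothesis of the bounded
      locale.\<close>
    from Y(1) obtain y where y: "y \<in> Y"
      by blast
    have "compact ((\<lambda>x. f x y) ` X)"
      using 13 by (intro compact_continuous_image continuous_on_x) simp
    from bounded_imp_bdd_below[OF compact_imp_bounded[OF this]] obtain l
      where "\<And>x. x \<in> X \<Longrightarrow> l \<le> f x y"
      by (auto simp: bdd_below_def)
    then have "bdd_below (max_val Y f ` X)"
      by (intro bdd_belowI2[of _ l] order_trans[OF _ max_val_ge[OF y]])
    then interpret bounded_minimax_problem X Y f L
      by unfold_locales
    obtain K where "K \<ge> 0" "\<And>w. saddle_gap w \<le> K * dual_shift w powr (1 / \<theta>)"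
      using KL_saddle_gap[of \<theta>] 13 by blast
    moreover have "0 < \<theta>" "\<theta> \<le> 1"
      using 13 by auto
    ultimately show ?case
      by (intro convergence_rate) simp_all
  qed (use L in simp_all)
qed

end
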